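(* Let $T=(V,E)$ be a finite tree with at least two vertices whose edges carry $s\times s$ real matrix weights $W(e)$ belonging to one of the following classes: (1) all weights $W(e)$ are (symmetric) positive definite matrices; (2) all weights $W(e)$ are lower triangular matrices with positive diagonal entries (or all are upper triangular matrices with positive diagonal entries). Then one of the following cases occurs: 1. There is a unique vertex $v$ such that there are two or more Perron branches at $v$ in $T$. 2. There is a unique pair of adjacent vertices $u\sim v$ such that the (unique) Perron branch at $u$ in $T$ is the branch $B_u(v)$ containing $v$, while the (unique) Perron branch at $v$ in $T$ is the branch $B_v(u)$ containing $u$.
   Context: Laplacian: for a tree $T=(V,E)$ on $n$ vertices with $s\times s$ matrix edge weights, $L=[l_{uv}]_{u,v\in V}$ is the $ns\times ns$ block matrix whose $s\times s$ blocks are: for $u\ne v$, $l_{uv}=-W(e)$ if $u,v$ are joined by the edge $e$, and $l_{uv}=\mathbf 0$ if $u,v$ are not adjacent; $l_{vv}$ is the sum of the weights of the edges incident with $v$. For $v\in V$, $L_v$ is $L$ with the row block and column block of $v$ deleted. When all weights are nonsingular, $L_v$ is invertible; put $M_v=L_v^{-1}$. A branch at $v$ is a connected component of the graph obtained from $T$ by deleting $v$ and its incident edges; $B_v(u)$ is the branch at $v$ containing $u$ ($u\neq v$). $M_v$ is block diagonal with one diagonal block $M_v(B)$, the bottleneck matrix of $B$ at $v$, for each branch $B$ at $v$; for $x,y\in B$ the $(x,y)$ block of $M_v(B)$ is $\sum_{e\in \mathcal P(x,v)\cap\mathcal P(y,v)}W(e)^{-1}$, where $\mathcal P(a,b)$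 is the path joining $a$ and $b$. Write $\rho(\cdot)$ for spectral radius. A branch $B$ at $v$ is a Perron branch at $v$ if $\rho(M_v(B))=\rho(M_v)$, equivalently if $\rho(M_v(B))$ is the largest among all branches at $v$. *)

theory Defs
  imports
    "HOL-Library.Countable_Set"
    "Jordan_Normal_Form.Gauss_Jordan_Elimination"
    "Jordan_Normal_Form.Spectral_Radius"
begin

text \<open>Simple undirected graphs with vertex set \<open>V\<close> and edge set \<open>E\<close>, an edge being a
  two-element set of vertices. (The predicate \<open>tree\<close> of the entry \<open>Graph_Theory\<close> is about
  digraphs and excludes directed cycles only.)\<close>

definition simple_graph :: "'v set \<Rightarrow> 'v set set \<Rightarrow> bool" where
  "simple_graph V E \<longleftrightarrow> finite V \<and> (\<forall>e\<in>E. \<exists>u\<in>V. \<exists>v\<in>V. u \<noteq> v \<and> e = {u, v})"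

definition joined :: "'v set \<Rightarrow> 'v set set \<Rightarrow> ('v \<times> 'v) set" where
  "joined V E = {(x, y). x \<in> V \<and> y \<in> V \<and> {x, y} \<in> E}\<^sup>*"

definition component_of :: "'v set \<Rightarrow> 'v set set \<Rightarrow> 'v \<Rightarrow> 'v set" where
  "component_of V E u = {x \<in> V. (u, x) \<in> joined V E}"

definition graph_connected :: "'v set \<Rightarrow> 'v set set \<Rightarrow> bool" where
  "graph_connected V E \<longleftrightarrow> V \<noteq> {} \<and> (\<forall>u\<in>V. \<forall>v\<in>V. (u, v) \<in> joined V E)"

definition graph_cycle :: "'v set set \<Rightarrow> 'v list \<Rightarrow> bool" where
  "graph_cycle E c \<longleftrightarrow> 3 \<le> length c \<and> distinct c \<and>
     (\<forall>i < length c. {c ! i, c ! (Suc i mod length c)} \<in> E)"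

definition finite_tree :: "'v set \<Rightarrow> 'v set set \<Rightarrow> bool" where
  "finite_tree V E \<longleftrightarrow> simple_graph V E \<and> graph_connected V E \<and> (\<nexists>c. graph_cycle E c)"

definition branch :: "'v set \<Rightarrow> 'v set set \<Rightarrow> 'v \<Rightarrow> 'v \<Rightarrow> 'v set" where
  "branch V E v u = component_of (V - {v}) {e \<in> E. v \<notin> e} u"

definition branches :: "'v set \<Rightarrow> 'v set set \<Rightarrow> 'v \<Rightarrow> 'v set set" where
  "branches V E v = branch V E v ` (V - {v})"


text \<open>Classes of \<open>s \<times> s\<close> weights.\<close>

definition positive_definite_mat :: "nat \<Rightarrow> real mat \<Rightarrow> bool" where
  "positive_definite_mat s A \<longleftrightarrow> A \<in> carrier_mat s s \<and> transpose_mat A = A \<and>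
     (\<forall>x \<in> carrier_vec s. x \<noteq> 0\<^sub>v s \<longrightarrow> 0 < x \<bullet> (A *\<^sub>v x))"

definition pos_diag_upper_mat :: "nat \<Rightarrow> real mat \<Rightarrow> bool" where
  "pos_diag_upper_mat s A \<longleftrightarrow> A \<in> carrier_mat s s \<and> upper_triangular A \<and> (\<forall>i<s. 0 < A $$ (i, i))"

definition pos_diag_lower_mat :: "nat \<Rightarrow> real mat \<Rightarrow> bool" where
  "pos_diag_lower_mat s A \<longleftrightarrow> A \<in> carrier_mat s s \<and> upper_triangular (transpose_mat A) \<and>
     (\<forall>i<s. 0 < A $$ (i, i))"


text \<open>Block matrices over a vertex set \<open>X\<close> have their rows and columns indexed by the set
  \<open>X \<times> {..<s}\<close>, the pair \<open>(x, i)\<close> being row (column) \<open>i\<close> of block \<open>x\<close>. The matrix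
  \<open>mat_on I A\<close> lists the entries \<open>A p q\<close> with \<open>p, q \<in> I\<close> along the fixed enumeration
  \<open>from_nat_into I\<close> of the finite index set \<open>I\<close>. The enumeration is used for both rows and
  columns, so another one gives a matrix similar by a permutation: the entries of the inverse
  addressed through indices, and the spectral radius, do not depend on it.\<close>

definition mat_on :: "'i set \<Rightarrow> ('i \<Rightarrow> 'i \<Rightarrow> 'a) \<Rightarrow> 'a mat" where
  "mat_on I A = mat (card I) (card I) (\<lambda>(i, j). A (from_nat_into I i) (from_nat_into I j))"

definition entry_on :: "'i set \<Rightarrow> 'a mat \<Rightarrow> 'i \<Rightarrow> 'i \<Rightarrow> 'a" where
  "entry_on I A p q = A $$ (to_nat_on I p, to_nat_on I q)"

definition real_spectral_radius :: "real mat \<Rightarrow> real" where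
  "real_spectral_radius A = spectral_radius (map_mat complex_of_real A)"

definition laplacian_block ::
    "'v set set \<Rightarrow> nat \<Rightarrow> ('v set \<Rightarrow> real mat) \<Rightarrow> 'v \<Rightarrow> 'v \<Rightarrow> real mat" where
  "laplacian_block E s W u v =
     (if u = v then mat s s (\<lambda>(i, j). \<Sum>e \<in> {e \<in> E. u \<in> e}. W e $$ (i, j))
      else if {u, v} \<in> E then - W {u, v}
      else 0\<^sub>m s s)"

definition laplacian ::
    "'v set set \<Rightarrow> nat \<Rightarrow> ('v set \<Rightarrow> real mat) \<Rightarrow> 'v \<times> nat \<Rightarrow> 'v \<times> nat \<Rightarrow> real" where
  "laplacian E s W p q = laplacian_block E s W (fst p) (fst q) $$ (snd p, snd q)"

definition reduced_laplacian ::
    "'v set \<Rightarrow> 'v set set \<Rightarrow> nat \<Rightarrow> ('v set \<Rightarrow> real mat) \<Rightarrow> 'v \<Rightarrow> real mat" where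
  "reduced_laplacian V E s W v = mat_on ((V - {v}) \<times> {..<s}) (laplacian E s W)"

definition inverse_reduced_laplacian ::
    "'v set \<Rightarrow> 'v set set \<Rightarrow> nat \<Rightarrow> ('v set \<Rightarrow> real mat) \<Rightarrow> 'v \<Rightarrow> real mat" where
  "inverse_reduced_laplacian V E s W v = the (mat_inverse (reduced_laplacian V E s W v))"

definition bottleneck_mat ::
    "'v set \<Rightarrow> 'v set set \<Rightarrow> nat \<Rightarrow> ('v set \<Rightarrow> real mat) \<Rightarrow> 'v \<Rightarrow> 'v set \<Rightarrow> real mat" where
  "bottleneck_mat V E s W v B =
     mat_on (B \<times> {..<s})
       (entry_on ((V - {v}) \<times> {..<s}) (inverse_reduced_laplacian V E s W v))"

definition perron_branch ::
    "'v set \<Rightarrow> 'v set set \<Rightarrow> nat \<Rightarrow> ('v set \<Rightarrow> real mat) \<Rightarrow> 'v \<Rightarrow> 'v set \<Rightarrow> bool" where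
  "perron_branch V E s W v B \<longleftrightarrow> B \<in> branches V E v \<and>
     real_spectral_radius (bottleneck_mat V E s W v B) =
     real_spectral_radius (inverse_reduced_laplacian V E s W v)"

end

theory Submission
  imports Defs "HOL-Analysis.Function_Topology"
begin

text \<open>For adjacent vertices \<open>v\<close>, \<open>u\<close> let \<open>f v u\<close> be the spectral radius of the bottleneck matrix of the
  branch at \<open>v\<close> containing \<open>u\<close>. In a tree the branches at \<open>v\<close> correspond to the neighbours of \<open>v\<close>,
  and \<open>M\<^sub>v\<close> is block diagonal, so the Perron branches at \<open>v\<close> correspond to the neighbours \<open>u\<close> that
  maximise \<open>f v u\<close>. Everything follows from one strict inequality: \<open>f u w < f v u\<close> whenever \<open>v\<close>, \<open>u\<close>, \<open>w\<close>
  is a walk with \<open>w \<noteq> v\<close>.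

  The combinatorial consequence is drawn in the locale \<open>decreasing_arcs\<close>. If \<open>w\<close> is a best neighbour of
  \<open>x\<close> and \<open>y \<noteq> w\<close> another neighbour, then \<open>f y x > f x w \<ge> f x y > f y z\<close> for all neighbours \<open>z \<noteq> x\<close> of \<open>y\<close>, so
  \<open>x\<close> is the only best neighbour of \<open>y\<close> (lemma \<open>best_points_back\<close>). Hence a vertex with two best
  neighbours, and likewise a pair of adjacent vertices that are the only best neighbours of each
  other, has all other vertices pointing towards it, which gives uniqueness and mutual exclusion. If
  there is no vertex of the first kind, following the best neighbours makes \<open>f\<close> decrease until it
  runs back and forth along an edge.

  For the inequality, the block of \<open>M\<^sub>v\<close> on a branch is the inverse of the block of the Laplacian, so
  its spectral radius is the reciprocal of the least modulus of an eigenvalue of the Laplacian on the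
  branch. For positive definite weights this is the minimum of a Rayleigh quotient, which does not
  increase when the branch grows from \<open>B\<^sub>u(w)\<close> to \<open>B\<^sub>v(u)\<close>; that it decreases strictly is lemma
  \<open>least_eigenvalue_branch_less\<close>. For triangular weights, sorting the rows by coordinate makes the
  Laplacian block triangular with the Laplacians for the scalar weights \<open>W(e)\<^sub>i\<^sub>i > 0\<close> on the diagonal.
  Its spectrum is the union of theirs, and the scalar case is an instance of the definite one
  (lemma \<open>spectral_gap_triangular\<close>).\<close>

section \<open>Graphs with weights decreasing along walks\<close>

definition best_neighbours :: "'v set set \<Rightarrow> ('v \<Rightarrow> 'v \<Rightarrow> real) \<Rightarrow> 'v \<Rightarrow> 'v set" where
  "best_neighbours E f v = {u. {v, u} \<in> E \<and> (\<forall>w. {v, w} \<in> E \<longrightarrow> f v w \<le> f v u)}"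

text \<open>The vertices from which following unique best neighbours leads into \<open>R\<close>. With an
  inductive definition the pointer chains need not be named, and uniqueness of paths is never used.\<close>

inductive_set points_towards :: "'v set set \<Rightarrow> ('v \<Rightarrow> 'v \<Rightarrow> real) \<Rightarrow> 'v set \<Rightarrow> 'v set"
  for E f R where
  root: "v \<in> R \<Longrightarrow> v \<in> points_towards E f R"
| follow: "best_neighbours E f y = {q} \<Longrightarrow> q \<in> points_towards E f R \<Longrightarrow> y \<in> points_towards E f R"

text \<open>The value \<open>f v u\<close> stands for the spectral radius of the bottleneck matrix of the branch at \<open>v\<close>
  through its neighbour \<open>u\<close>. All that the combinatorial part uses is that it drops along
  non-backtracking walks; acyclicity enters only when this is proved for bottleneck matrices.\<close>

locale decreasing_arcs =
  fixes V :: "'v set" and E :: "'v set set" and f :: "'v \<Rightarrow> 'v \<Rightarrow> real"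
  assumes fin: "finite V"
    and edge_in: "\<And>u v. {u, v} \<in> E \<Longrightarrow> u \<in> V \<and> v \<in> V \<and> u \<noteq> v"
    and conn: "graph_connected V E"
    and card_ge: "2 \<le> card V"
    and decreasing: "\<And>u v w. {v, u} \<in> E \<Longrightarrow> {u, w} \<in> E \<Longrightarrow> w \<noteq> v \<Longrightarrow> f u w < f v u"
begin

abbreviation best where "best \<equiv> best_neighbours E f"

lemma best_subset: "best v \<subseteq> V"
  using edge_in by (auto simp: best_neighbours_def)

lemma finite_best: "finite (best v)"
  using best_subset fin finite_subset by blast

lemma ex_neighbour: assumes "v \<in> V" shows "\<exists>u. {v, u} \<in> E"
proof -
  have "V \<noteq> {v}" using card_ge by auto
  then obtain x where x: "x \<in> V" "x \<noteq> v" using assms by blast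
  then have "(v, x) \<in> joined V E" using conn assms by (auto simp: graph_connected_def)
  then show ?thesis using x unfolding joined_def by (cases rule: converse_rtranclE) auto
qed

lemma best_nonempty: assumes "v \<in> V" shows "best v \<noteq> {}"
proof -
  let ?N = "{u. {v, u} \<in> E}"
  have N: "finite ?N" "?N \<noteq> {}"
    using ex_neighbour[OF assms] finite_subset[OF _ fin, of ?N] edge_in by auto
  define m where "m = Max (f v ` ?N)"
  have "m \<in> f v ` ?N" unfolding m_def using N by (intro Max_in) auto
  then obtain u where "u \<in> ?N" "f v u = m" by auto
  moreover have "f v w \<le> m" if "w \<in> ?N" for w
    unfolding m_def using N that by (intro Max_ge) auto
  ultimately show ?thesis by (auto simp: best_neighbours_def)
qed

text \<open>Two steps of strict decrease on either side of the maximality of \<open>f x w\<close>: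
  \<open>f y x > f x w \<ge> f x y > f y z\<close> for every other neighbour \<open>z\<close> of \<open>y\<close>.\<close>

lemma best_points_back:
  assumes w: "w \<in> best x" and xy: "{x, y} \<in> E" and "y \<noteq> w"
  shows "best y = {x}"
proof -
  have yx: "{y, x} \<in> E" using xy by (simp add: insert_commute)
  have xw: "{x, w} \<in> E" "f x y \<le> f x w" using w xy by (auto simp: best_neighbours_def)
  have 1: "f x w < f y x" using decreasing[OF yx xw(1)] assms(3) by auto
  have "f y z < f y x" if "{y, z} \<in> E" "z \<noteq> x" for z
    using decreasing[OF xy that] xw(2) 1 by linarith
  then have *: "{y, z} \<in> E \<Longrightarrow> z = x \<or> f y z < f y x" for z by blast
  show ?thesis
  proof (intro equalityI subsetI)
    fix z assume "z \<in> best y"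
    then have "{y, z} \<in> E" "f y x \<le> f y z" using yx by (auto simp: best_neighbours_def)
    then show "z \<in> {x}" using *[of z] by simp
  next
    fix z assume "z \<in> {x}"
    moreover have "f y t \<le> f y x" if "{y, t} \<in> E" for t using *[OF that] by auto
    ultimately show "z \<in> best y" using yx by (simp add: best_neighbours_def)
  qed
qed

text \<open>If the outside neighbours of a root point back to it, the roots attract the whole graph:
  a vertex next to an attracted \<open>y\<close> is either the one \<open>y\<close> points to, or
  points to \<open>y\<close>. No path has to be kept track of.\<close>

lemma points_towards_all:
  assumes r: "r \<in> R" "r \<in> V"
    and R: "\<And>x y. x \<in> R \<Longrightarrow> {x, y} \<in> E \<Longrightarrow> y \<notin> R \<Longrightarrow> best y = {x}"
    and x: "x \<in> V"
  shows "x \<in> points_towards E f R"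
proof -
  have "(r, x) \<in> joined V E" using conn r x by (auto simp: graph_connected_def)
  then show ?thesis unfolding joined_def
  proof (induction rule: rtrancl_induct)
    case base show ?case by (rule points_towards.root[OF r(1)])
  next
    case (step y z)
    then have yz: "{y, z} \<in> E" by auto
    from step.IH show ?case
    proof cases
      case root
      then show ?thesis using R[OF root yz] points_towards.intros step.IH by metis
    next
      case (follow q)
      then show ?thesis
        using best_points_back[of q y z] yz points_towards.follow[of E f z y R] step.IH by blast
    qed
  qed
qed

lemma points_towards_single:
  assumes "x \<in> points_towards E f R" "x \<notin> R"
  obtains q where "best x = {q}" "q \<in> points_towards E f R"
  using assms by (cases rule: points_towards.cases) auto

text \<open>A mutual pair outside \<open>R\<close> traps its pointer chains.\<close>

lemma not_points_away:
  assumes "best a = {b}" "best b = {a}" "a \<notin> R" "b \<notin> R" "x \<in> points_towards E f R"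
  shows "x \<noteq> a \<and> x \<noteq> b"
  using assms(5)
  by induction (use assms(1-4) in auto)

text \<open>Each neighbour \<open>y\<close> of \<open>v\<close> differs from one of the best neighbours of \<open>v\<close> and so points back to
  \<open>v\<close>; hence \<open>{v}\<close> attracts the whole graph.\<close>

lemma unique_branching_vertex:
  assumes v: "v \<in> V" "2 \<le> card (best v)"
  shows "\<exists>!v. v \<in> V \<and> 2 \<le> card (best v)"
    and "\<not> (best a = {b} \<and> best b = {a})"
proof -
  have *: "best y = {v}" if "{v, y} \<in> E" for y
  proof -
    have "\<not> best v \<subseteq> {y}" using v(2) card_mono[of "{y}" "best v"] by auto
    then show ?thesis using best_points_back that by blast
  qed
  have all: "x \<in> points_towards E f {v}" if "x \<in> V" for x
    by (rule points_towards_all[of v]) (use v(1) * that in auto)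
  have "u = v" if "u \<in> V" "2 \<le> card (best u)" for u
  proof (rule ccontr)
    assume "u \<noteq> v"
    then have "u \<notin> {v}" by simp
    from points_towards_single[OF all[OF that(1)] this] obtain q where "best u = {q}" by metis
    then show False using that(2) by simp
  qed
  then show "\<exists>!v. v \<in> V \<and> 2 \<le> card (best v)" using v by blast
  show "\<not> (best a = {b} \<and> best b = {a})"
  proof
    assume ab: "best a = {b} \<and> best b = {a}"
    then have "a \<noteq> v" "b \<noteq> v" using v(2) by auto
    moreover have "a \<in> V" using ab best_subset by blast
    ultimately show False using not_points_away[of a b "{v}" a] ab all by blast
  qed
qed

text \<open>The same argument with the two ends of the edge as the attracting set.\<close>

lemma unique_central_edge:
  assumes ab: "best a = {b}" "best b = {a}" and cd: "best c = {d}" "best d = {c}"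
  shows "{a, b} = {c, d}"
proof (rule ccontr)
  assume ne: "{a, b} \<noteq> {c, d}"
  have "a \<in> V" "c \<in> V" using ab(2) cd(2) best_subset by blast+
  have "c \<noteq> a" "c \<noteq> b" "d \<noteq> a" "d \<noteq> b" using ne ab cd by auto
  moreover have "c \<in> points_towards E f {a, b}"
  proof (rule points_towards_all[of a])
    fix x y assume "x \<in> {a, b}" "{x, y} \<in> E" "y \<notin> {a, b}"
    then show "best y = {x}" using best_points_back[of b a y] best_points_back[of a b y] ab by auto
  qed (use \<open>a \<in> V\<close> \<open>c \<in> V\<close> in auto)
  ultimately show False using not_points_away[of c d "{a, b}" c] cd by auto
qed

text \<open>Following the best neighbours strictly decreases \<open>f v (best v)\<close> except across a
  mutual pair, so a vertex minimising it lies in one.\<close>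

lemma ex_central_edge:
  assumes single: "\<And>v. v \<in> V \<Longrightarrow> \<not> 2 \<le> card (best v)"
  shows "\<exists>a b. best a = {b} \<and> best b = {a}"
proof -
  have "\<exists>q. best v = {q}" if "v \<in> V" for v
  proof -
    have "card (best v) \<noteq> 0" using best_nonempty[OF that] finite_best by simp
    with single[OF that] have "card (best v) = 1" by linarith
    then show ?thesis by (auto simp: card_1_singleton_iff)
  qed
  then obtain p where p: "\<And>v. v \<in> V \<Longrightarrow> best v = {p v}" by metis
  have pe: "{v, p v} \<in> E" "p v \<in> V" if "v \<in> V" for v
    using p[OF that] edge_in by (auto simp: best_neighbours_def)
  have "V \<noteq> {}" using card_ge by auto
  then have "\<exists>v\<in>V. \<forall>x\<in>V. f v (p v) \<le> f x (p x)"
    using arg_min_if_finite[OF fin, of "\<lambda>v. f v (p v)"] by (meson not_less)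
  then obtain v where v: "v \<in> V" "\<And>x. x \<in> V \<Longrightarrow> f v (p v) \<le> f x (p x)" by blast
  have "p (p v) = v"
    using decreasing[OF pe(1)[OF v(1)] pe(1)[OF pe(2)[OF v(1)]]] v(2)[OF pe(2)[OF v(1)]]
    by linarith
  then show ?thesis using p[OF v(1)] p[OF pe(2)[OF v(1)]] by auto
qed

lemma best_neighbour_dichotomy:
  defines "c1 \<equiv> \<exists>!v. v \<in> V \<and> 2 \<le> card (best v)"
    and "c2 \<equiv> \<exists>!e. e \<in> E \<and> (\<exists>u v. e = {u, v} \<and> best u = {v} \<and> best v = {u})"
  shows "(c1 \<or> c2) \<and> \<not> (c1 \<and> c2)"
proof (cases "\<exists>v\<in>V. 2 \<le> card (best v)")
  case True
  then obtain v where v: "v \<in> V" "2 \<le> card (best v)" by blast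
  have c1 unfolding c1_def by (rule unique_branching_vertex(1)[OF v])
  moreover have "\<not> c2" unfolding c2_def using unique_branching_vertex(2)[OF v] by blast
  ultimately show ?thesis by blast
next
  case False
  then have "\<exists>a b. best a = {b} \<and> best b = {a}" by (intro ex_central_edge) blast
  then obtain a b where ab: "best a = {b}" "best b = {a}" by blast
  then have abE: "{a, b} \<in> E" by (auto simp: best_neighbours_def)
  have c2 unfolding c2_def
  proof (rule ex1I[of _ "{a, b}"])
    show "{a, b} \<in> E \<and> (\<exists>u v. {a, b} = {u, v} \<and> best u = {v} \<and> best v = {u})"
      using abE ab by blast
  next
    fix e assume "e \<in> E \<and> (\<exists>u v. e = {u, v} \<and> best u = {v} \<and> best v = {u})"
    then obtain u v where uv: "e = {u, v}" "best u = {v}" "best v = {u}" by blast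
    show "e = {a, b}" unfolding uv(1) by (rule unique_central_edge[OF uv(2,3) ab])
  qed
  moreover have "\<not> c1" unfolding c1_def using False by blast
  ultimately show ?thesis by blast
qed

end

section \<open>Branches of a tree\<close>

locale tree_graph =
  fixes V :: "'v set" and E :: "'v set set"
  assumes tree: "finite_tree V E"
begin

lemma finite_V: "finite V" using tree by (simp add: finite_tree_def simple_graph_def)

lemma edgeD:
  assumes "{u, v} \<in> E" shows "u \<in> V" "v \<in> V" "u \<noteq> v"
proof -
  obtain a b where "a \<in> V" "b \<in> V" "a \<noteq> b" "{u, v} = {a, b}"
    using tree assms unfolding finite_tree_def simple_graph_def by blast
  then show "u \<in> V" "v \<in> V" "u \<noteq> v" by (auto simp: doubleton_eq_iff)
qed

definition step_avoiding :: "'v \<Rightarrow> ('v \<times> 'v) set" where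
  "step_avoiding v = {(x, y). {x, y} \<in> E \<and> x \<noteq> v \<and> y \<noteq> v}"

lemma branch_iff: "x \<in> branch V E v u \<longleftrightarrow> x \<in> V - {v} \<and> (u, x) \<in> (step_avoiding v)\<^sup>*"
proof -
  have "{(x, y). x \<in> V - {v} \<and> y \<in> V - {v} \<and> {x, y} \<in> {e \<in> E. v \<notin> e}} = step_avoiding v"
    using edgeD by (auto simp: step_avoiding_def)
  then show ?thesis by (simp add: branch_def component_of_def joined_def)
qed

lemma sym_step: "sym ((step_avoiding v)\<^sup>*)"
  by (rule sym_rtrancl) (auto simp: sym_def step_avoiding_def insert_commute)

lemma branch_refl: "u \<in> V \<Longrightarrow> u \<noteq> v \<Longrightarrow> u \<in> branch V E v u"
  by (simp add: branch_iff)

lemma neighbour_in_own_branch: assumes "{v, u} \<in> E" shows "u \<in> branch V E v u"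
  using branch_refl[of u v] edgeD[OF assms] by simp

lemma branch_subset: "branch V E v u \<subseteq> V - {v}"
  by (auto simp: branch_iff)

lemma branch_eq: assumes "x \<in> branch V E v u" shows "branch V E v x = branch V E v u"
proof -
  have "(u, x) \<in> (step_avoiding v)\<^sup>*" "(x, u) \<in> (step_avoiding v)\<^sup>*"
    using assms symD[OF sym_step] by (auto simp: branch_iff)
  then have "(x, y) \<in> (step_avoiding v)\<^sup>* \<longleftrightarrow> (u, y) \<in> (step_avoiding v)\<^sup>*" for y
    by (meson rtrancl_trans)
  then show ?thesis by (simp add: set_eq_iff branch_iff)
qed

lemma branch_closed:
  assumes "x \<in> branch V E v u" "{x, y} \<in> E" "y \<noteq> v" shows "y \<in> branch V E v u"
proof -
  have "x \<noteq> v" using assms(1) by (auto simp: branch_iff)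
  then have "(x, y) \<in> step_avoiding v" using assms by (simp add: step_avoiding_def)
  then show ?thesis
    using assms edgeD(2)[OF assms(2)] by (auto simp: branch_iff intro: rtrancl_into_rtrancl)
qed

lemma ex_distinct_walk:
  assumes "(x, y) \<in> R\<^sup>*"
  shows "\<exists>p. p \<noteq> [] \<and> hd p = x \<and> last p = y \<and> distinct p \<and> successively (\<lambda>a b. (a, b) \<in> R) p"
  using assms
proof (induction rule: converse_rtrancl_induct)
  case base show ?case by (rule exI[of _ "[y]"]) simp
next
  case (step x z)
  then obtain p where p: "p \<noteq> []" "hd p = z" "last p = y" "distinct p"
    "successively (\<lambda>a b. (a, b) \<in> R) p" by blast
  show ?case
  proof (cases "x \<in> set p")
    case True
    \<comment> \<open>The walk returns to \<open>x\<close>: cut off the loop.\<close>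
    then obtain ps qs where "p = ps @ x # qs" by (meson split_list)
    then show ?thesis using p by (intro exI[of _ "x # qs"]) (auto simp: successively_append_iff)
  next
    case False
    then show ?thesis using p step.hyps
      by (intro exI[of _ "x # p"]) (auto simp: successively_Cons)
  qed
qed

text \<open>Two neighbours of \<open>v\<close> in one branch would close a cycle through \<open>v\<close>.\<close>

lemma neighbours_separated:
  assumes vu: "{v, u} \<in> E" and vw: "{v, w} \<in> E" and ne: "u \<noteq> w"
  shows "w \<notin> branch V E v u"
proof
  assume "w \<in> branch V E v u"
  then have "(u, w) \<in> (step_avoiding v)\<^sup>*" by (simp add: branch_iff)
  from ex_distinct_walk[OF this] obtain p where p: "p \<noteq> []" "hd p = u" "last p = w" "distinct p"
    and succ: "successively (\<lambda>a b. (a, b) \<in> step_avoiding v) p" by blast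
  have len: "2 \<le> length p" using p ne by (cases p; cases "tl p") auto
  have edge: "{p ! i, p ! Suc i} \<in> E" "p ! i \<noteq> v" "p ! Suc i \<noteq> v" if "Suc i < length p" for i
    using successively_nth[OF succ that] by (auto simp: step_avoiding_def)
  have "v \<notin> set p"
  proof
    assume "v \<in> set p"
    then obtain i where i: "i < length p" "p ! i = v" by (auto simp: in_set_conv_nth)
    show False
    proof (cases i)
      case 0 then show False using edge(2)[of 0] i len by simp
    next
      case (Suc j) then show False using edge(3)[of j] i by simp
    qed
  qed
  moreover have "{(v # p) ! i, (v # p) ! (Suc i mod length (v # p))} \<in> E"
    if i: "i < length (v # p)" for i
  proof (cases "i = length p")
    case True
    then have "(v # p) ! i = w" using p by (cases p rule: rev_cases) auto
    then show ?thesis using True vw by (simp add: insert_commute)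
  next
    case False
    then have m: "Suc i mod length (v # p) = Suc i" using i by simp
    show ?thesis
    proof (cases i)
      case 0 then show ?thesis unfolding m using p vu by (simp add: hd_conv_nth)
    next
      case (Suc j) then show ?thesis unfolding m using edge(1)[of j] i False by simp
    qed
  qed
  ultimately have "graph_cycle E (v # p)" using p len by (simp add: graph_cycle_def)
  then show False using tree by (auto simp: finite_tree_def)
qed

lemma neighbour_in_branch:
  assumes v: "v \<in> V" and x: "x \<in> V" "x \<noteq> v"
  obtains u where "{v, u} \<in> E" "branch V E v u = branch V E v x"
proof -
  have "(v, x) \<in> joined V E" using tree v x by (auto simp: finite_tree_def graph_connected_def)
  then have "x = v \<or> (\<exists>u. {v, u} \<in> E \<and> x \<in> branch V E v u)"
    unfolding joined_def
  proof (induction rule: rtrancl_induct)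
    case base then show ?case by simp
  next
    case (step y z)
    then have yz: "{y, z} \<in> E" by auto
    show ?case
    proof (cases "z = v \<or> y = v")
      case True then show ?thesis 
        using yz edgeD(2)[OF yz] branch_refl[of z v] by blast
    next
      case False then show ?thesis using step.IH branch_closed[of y v] yz by blast
    qed
  qed
  then obtain u where "{v, u} \<in> E" "x \<in> branch V E v u" using x by blast
  then show ?thesis using branch_eq that by simp
qed

lemma branches_eq: assumes "v \<in> V" shows "branches V E v = branch V E v ` {u. {v, u} \<in> E}"
proof -
  have "branch V E v x \<in> branch V E v ` {u. {v, u} \<in> E}" if "x \<in> V - {v}" for x
    using neighbour_in_branch[OF assms, of x] that by (metis DiffD1 DiffD2 imageI mem_Collect_eq singletonI)
  moreover have "{u. {v, u} \<in> E} \<subseteq> V - {v}" using edgeD by fast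
  ultimately show ?thesis unfolding branches_def by (intro equalityI image_mono image_subsetI)
qed

lemma inj_on_branch: "inj_on (branch V E v) {u. {v, u} \<in> E}"
proof (rule inj_onI)
  fix u w assume "u \<in> {u. {v, u} \<in> E}" "w \<in> {u. {v, u} \<in> E}"
    and eq: "branch V E v u = branch V E v w"
  then have E: "{v, u} \<in> E" "{v, w} \<in> E" by auto
  have "w \<in> branch V E v u" unfolding eq by (rule neighbour_in_own_branch[OF E(2)])
  then show "u = w" using neighbours_separated[OF E] by blast
qed

lemma only_neighbour_in_branch:
  assumes "{v, w} \<in> E" "x \<in> branch V E v w" "{v, x} \<in> E" shows "x = w"
  using neighbours_separated[OF assms(1,3)] assms(2) by blast

text \<open>A walk from \<open>x\<close> to \<open>u\<close> avoiding \<open>w\<close> arrives at \<open>u\<close> through a neighbour other than \<open>w\<close>, which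
  would put \<open>x\<close> into a second branch at \<open>u\<close>.\<close>

lemma sides_disjoint:
  assumes uw: "{u, w} \<in> E" and x: "x \<in> branch V E u w"
  shows "x \<notin> branch V E w u"
proof
  assume "x \<in> branch V E w u"
  then have "(u, x) \<in> (step_avoiding w)\<^sup>*" by (simp add: branch_iff)
  then have "x = u \<or> (\<exists>t. {u, t} \<in> E \<and> t \<noteq> w \<and> x \<in> branch V E u t)"
  proof (induction rule: rtrancl_induct)
    case (step y z)
    then have yz: "{y, z} \<in> E" "z \<noteq> w" by (auto simp: step_avoiding_def)
    show ?case
    proof (cases "z = u \<or> y = u")
      case True then show ?thesis 
        using yz edgeD(2)[OF yz(1)] branch_refl[of z u] by blast
    next
      case False then show ?thesis using step.IH branch_closed[of y u] yz by blast
    qed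
  qed simp
  moreover have "x \<noteq> u" using x branch_subset by blast
  ultimately obtain t where t: "{u, t} \<in> E" "t \<noteq> w" "x \<in> branch V E u t" by blast
  have "t \<in> branch V E u t" by (rule neighbour_in_own_branch[OF t(1)])
  then have "t \<in> branch V E u w" using branch_eq[OF t(3)] branch_eq[OF x] by simp
  then show False using neighbours_separated[OF uw t(1)] t(2) by simp
qed

text \<open>The branch \<open>B\<^sub>u(w)\<close> misses \<open>v\<close>, so its walks survive the deletion of \<open>v\<close>, and the edge
  \<open>{u, w}\<close> ties it to \<open>u\<close>. Properness is what makes an induction along nested branches end.\<close>

lemma branch_psubset:
  assumes vu: "{v, u} \<in> E" and uw: "{u, w} \<in> E" and "w \<noteq> v"
  shows "branch V E u w \<subset> branch V E v u"
proof -
  have u: "u \<in> branch V E v u" by (rule neighbour_in_own_branch[OF vu])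
  have "v \<notin> branch V E u w"
    using neighbours_separated[of u w v] vu uw assms(3) by (auto simp: insert_commute)
  have "x \<in> branch V E v u" if x: "x \<in> branch V E u w" for x
  proof -
    have "(w, x) \<in> (step_avoiding u)\<^sup>*" using x by (simp add: branch_iff)
    then have "x \<in> branch V E v u \<and> x \<in> branch V E u w"
    proof (induction rule: rtrancl_induct)
      case base
      show ?case 
        using branch_closed[OF u uw assms(3)] neighbour_in_own_branch[OF uw] by blast
    next
      case (step y z)
      then have yz: "{y, z} \<in> E" "z \<noteq> u" by (auto simp: step_avoiding_def)
      have "z \<in> branch V E u w" using branch_closed step.IH yz by blast
      moreover from this have "z \<noteq> v" using \<open>v \<notin> branch V E u w\<close> by blast
      ultimately show ?case using branch_closed step.IH yz by blast
    qed
    then show ?thesis ..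
  qed
  moreover have "u \<notin> branch V E u w" using branch_subset by blast
  ultimately show ?thesis using u by blast
qed

text \<open>Below \<open>w\<close> the branch \<open>B\<^sub>u(w)\<close> splits into branches at \<open>w\<close>, none of which leads back to \<open>u\<close>.\<close>

lemma subbranch:
  assumes uw: "{u, w} \<in> E" and x: "x \<in> branch V E u w" "x \<noteq> w"
  obtains t where "{w, t} \<in> E" "t \<noteq> u" "branch V E w t = branch V E w x"
    "x \<in> branch V E w t"
proof -
  have xV: "x \<in> V" using x branch_subset by blast
  have "w \<in> V" using edgeD(2)[OF uw] .
  from neighbour_in_branch[OF this xV x(2)] obtain t where t: "{w, t} \<in> E"
    "branch V E w t = branch V E w x" by metis
  have xt: "x \<in> branch V E w t" unfolding t(2) by (rule branch_refl[OF xV x(2)])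
  then have "t \<noteq> u" using sides_disjoint[OF uw x(1)] by blast
  then show ?thesis using that t xt by blast
qed

end

section \<open>Matrices over a finite index set\<close>

text \<open>Eigenvectors as functions on the index set itself: extending a vector by zero and restricting it
  to a branch then need no renumbering.\<close>

definition eigenvalue_on :: "'i set \<Rightarrow> ('i \<Rightarrow> 'i \<Rightarrow> 'a::field) \<Rightarrow> 'a \<Rightarrow> bool" where
  "eigenvalue_on I A \<mu> \<longleftrightarrow>
     (\<exists>x. (\<exists>p\<in>I. x p \<noteq> 0) \<and> (\<forall>p\<in>I. (\<Sum>q\<in>I. A p q * x q) = \<mu> * x p))"

lemma eigenvalue_onI:
  "p \<in> I \<Longrightarrow> x p \<noteq> 0 \<Longrightarrow> (\<And>p. p \<in> I \<Longrightarrow> (\<Sum>q\<in>I. A p q * x q) = \<mu> * x p) \<Longrightarrow> eigenvalue_on I A \<mu>"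
  unfolding eigenvalue_on_def by (intro exI[of _ x] conjI bexI[of _ p] ballI) simp_all

lemma eigenvalue_onE:
  assumes "eigenvalue_on I A \<mu>"
  obtains x p where "p \<in> I" "x p \<noteq> 0" "\<And>p. p \<in> I \<Longrightarrow> (\<Sum>q\<in>I. A p q * x q) = \<mu> * x p"
  using assms unfolding eigenvalue_on_def by auto

lemma eigenvalue_on_cong:
  "(\<And>p q. p \<in> I \<Longrightarrow> q \<in> I \<Longrightarrow> A p q = B p q) \<Longrightarrow> eigenvalue_on I A \<mu> = eigenvalue_on I B \<mu>"
  by (simp add: eigenvalue_on_def)

lemma eigenvalue_on_of_real:
  assumes "eigenvalue_on I A m"
  shows "eigenvalue_on I (\<lambda>p q. complex_of_real (A p q)) (complex_of_real m)"
proof -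
  obtain x p0 where x: "p0 \<in> I" "x p0 \<noteq> 0" "\<And>p. p \<in> I \<Longrightarrow> (\<Sum>q\<in>I. A p q * x q) = m * x p"
    using eigenvalue_onE[OF assms] by metis
  show ?thesis
  proof (rule eigenvalue_onI[of p0 I "\<lambda>q. complex_of_real (x q)"])
    fix p assume "p \<in> I"
    from arg_cong[OF x(3)[OF this], of complex_of_real]
    show "(\<Sum>q\<in>I. complex_of_real (A p q) * complex_of_real (x q)) = complex_of_real m * complex_of_real (x p)"
      by simp
  qed (use x in simp_all)
qed

lemma from_nat_into_props:
  assumes "finite I"
  shows "i < card I \<Longrightarrow> from_nat_into I i \<in> I"
    and "i < card I \<Longrightarrow> to_nat_on I (from_nat_into I i) = i"
    and "p \<in> I \<Longrightarrow> to_nat_on I p < card I"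
    and "p \<in> I \<Longrightarrow> from_nat_into I (to_nat_on I p) = p"
proof -
  have b: "bij_betw (to_nat_on I) I {..<card I}" "bij_betw (from_nat_into I) {..<card I} I"
    using assms by (simp_all add: to_nat_on_finite bij_betw_from_nat_into_finite)
  show "i < card I \<Longrightarrow> from_nat_into I i \<in> I" using b(2) by (auto simp: bij_betw_def)
  show "p \<in> I \<Longrightarrow> to_nat_on I p < card I" using b(1) by (auto simp: bij_betw_def)
  show "i < card I \<Longrightarrow> to_nat_on I (from_nat_into I i) = i"
    using b(1) by (intro to_nat_on_from_nat_into) (auto simp: bij_betw_def)
  show "p \<in> I \<Longrightarrow> from_nat_into I (to_nat_on I p) = p"
    using assms by (simp add: countable_finite)
qed

lemma sum_from_nat_into:
  assumes "finite I" shows "(\<Sum>j<card I. g (from_nat_into I j)) = sum g I"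
  by (rule sum.reindex_bij_betw[OF bij_betw_from_nat_into_finite[OF assms]])

lemma mat_on_carrier [simp]: "mat_on I A \<in> carrier_mat (card I) (card I)"
  by (simp add: mat_on_def)

lemma mat_on_mult_vec:
  assumes "finite I"
  shows "mat_on I A *\<^sub>v vec (card I) (\<lambda>j. x (from_nat_into I j)) =
    vec (card I) (\<lambda>i. \<Sum>q\<in>I. A (from_nat_into I i) q * x q)"
  by (rule eq_vecI)
    (simp_all add: mat_on_def scalar_prod_def lessThan_atLeast0[symmetric] sum_from_nat_into[OF assms, symmetric])

lemma mat_on_mult:
  assumes "finite I"
  shows "mat_on I A * mat_on I B = mat_on I (\<lambda>p r. \<Sum>q\<in>I. A p q * B q r)"
  by (rule eq_matI)
    (simp_all add: mat_on_def scalar_prod_def lessThan_atLeast0[symmetric] sum_from_nat_into[OF assms, symmetric])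

lemma mat_on_eq_iff:
  assumes "finite I"
  shows "mat_on I A = mat_on I B \<longleftrightarrow> (\<forall>p\<in>I. \<forall>q\<in>I. A p q = B p q)"
proof
  assume eq: "mat_on I A = mat_on I B"
  show "\<forall>p\<in>I. \<forall>q\<in>I. A p q = B p q"
  proof (intro ballI)
    fix p q assume pq: "p \<in> I" "q \<in> I"
    have "mat_on I A $$ (to_nat_on I p, to_nat_on I q) = mat_on I B $$ (to_nat_on I p, to_nat_on I q)"
      unfolding eq by (rule refl)
    then show "A p q = B p q" using pq from_nat_into_props[OF assms] by (simp add: mat_on_def)
  qed
next
  assume "\<forall>p\<in>I. \<forall>q\<in>I. A p q = B p q"
  then show "mat_on I A = mat_on I B"
    by (intro eq_matI) (simp_all add: mat_on_def from_nat_into_props[OF assms])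
qed

lemma mat_on_entry_on:
  assumes "finite I" "N \<in> carrier_mat (card I) (card I)"
  shows "mat_on I (entry_on I N) = N"
  using assms by (intro eq_matI) (simp_all add: mat_on_def entry_on_def from_nat_into_props)

lemma one_mat_on:
  assumes "finite I" shows "1\<^sub>m (card I) = mat_on I (\<lambda>p q. if p = q then 1 else 0)"
proof (rule eq_matI)
  fix i j assume "i < dim_row (mat_on I (\<lambda>p q. if p = q then 1 else 0 :: 'b))"
    "j < dim_col (mat_on I (\<lambda>p q. if p = q then 1 else 0 :: 'b))"
  then have ij: "i < card I" "j < card I" by (simp_all add: mat_on_def)
  then have "from_nat_into I i = from_nat_into I j \<longleftrightarrow> i = j"
    using from_nat_into_props(2)[OF assms] by metis
  then show "1\<^sub>m (card I) $$ (i, j) = mat_on I (\<lambda>p q. if p = q then 1 else 0) $$ (i, j)"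
    using ij by (simp add: mat_on_def)
qed (simp_all add: mat_on_def)

lemma eigenvalue_mat_on:
  assumes fin: "finite I"
  shows "eigenvalue (mat_on I A) \<mu> \<longleftrightarrow> eigenvalue_on I A \<mu>"
proof -
  let ?e = "from_nat_into I" and ?n = "card I"
  note P = from_nat_into_props[OF fin]
  have dim: "dim_row (mat_on I A) = ?n" by (simp add: mat_on_def)
  have ev: "eigenvector (mat_on I A) (vec ?n (\<lambda>j. x (?e j))) \<mu> \<longleftrightarrow>
      (\<exists>p\<in>I. x p \<noteq> 0) \<and> (\<forall>p\<in>I. (\<Sum>q\<in>I. A p q * x q) = \<mu> * x p)" for x
  proof -
    have all: "(\<forall>i<?n. R (?e i)) \<longleftrightarrow> (\<forall>p\<in>I. R p)" for R using P by metis
    have "vec ?n (\<lambda>j. x (?e j)) = 0\<^sub>v ?n \<longleftrightarrow> (\<forall>p\<in>I. x p = 0)"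
      unfolding vec_eq_iff using all[of "\<lambda>p. x p = 0"] by simp
    moreover have "mat_on I A *\<^sub>v vec ?n (\<lambda>j. x (?e j)) = \<mu> \<cdot>\<^sub>v vec ?n (\<lambda>j. x (?e j)) \<longleftrightarrow>
        (\<forall>p\<in>I. (\<Sum>q\<in>I. A p q * x q) = \<mu> * x p)"
      unfolding mat_on_mult_vec[OF fin] vec_eq_iff
      using all[of "\<lambda>p. (\<Sum>q\<in>I. A p q * x q) = \<mu> * x p"] by simp
    ultimately show ?thesis unfolding eigenvector_def dim by simp
  qed
  have "eigenvalue_on I A \<mu>" if "eigenvector (mat_on I A) w \<mu>" for w
  proof -
    have "w \<in> carrier_vec ?n" using that by (simp add: eigenvector_def dim)
    then have "w = vec ?n (\<lambda>j. w $ to_nat_on I (?e j))" by (intro eq_vecI) (simp_all add: P)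
    with that have "eigenvector (mat_on I A) (vec ?n (\<lambda>j. w $ to_nat_on I (?e j))) \<mu>" by simp
    from iffD1[OF ev[of "\<lambda>p. w $ to_nat_on I p"] this] show ?thesis
      unfolding eigenvalue_on_def by (rule exI[of _ "\<lambda>p. w $ to_nat_on I p"])
  qed
  moreover have "\<exists>w. eigenvector (mat_on I A) w \<mu>" if "eigenvalue_on I A \<mu>"
  proof -
    from that obtain x where "(\<exists>p\<in>I. x p \<noteq> 0) \<and> (\<forall>p\<in>I. (\<Sum>q\<in>I. A p q * x q) = \<mu> * x p)"
      unfolding eigenvalue_on_def by (rule exE)
    from iffD2[OF ev this] show ?thesis by (rule exI)
  qed
  ultimately show ?thesis unfolding eigenvalue_def by blast
qed

lemma mat_inverse_mat_on:
  fixes A :: "'i \<Rightarrow> 'i \<Rightarrow> 'a::field"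
  assumes fin: "finite I" and inv: "\<not> eigenvalue_on I A 0"
  defines "N \<equiv> the (mat_inverse (mat_on I A))"
  defines "G \<equiv> entry_on I N"
  shows "N = mat_on I G"
    and "p \<in> I \<Longrightarrow> r \<in> I \<Longrightarrow> (\<Sum>q\<in>I. A p q * G q r) = (if p = r then 1 else 0)"
    and "p \<in> I \<Longrightarrow> r \<in> I \<Longrightarrow> (\<Sum>q\<in>I. G p q * A q r) = (if p = r then 1 else 0)"
proof -
  let ?n = "card I" and ?M = "mat_on I A"
  have "det ?M \<noteq> 0"
  proof
    assume "det ?M = 0"
    then obtain v where "v \<in> carrier_vec ?n" "v \<noteq> 0\<^sub>v ?n" "?M *\<^sub>v v = 0\<^sub>v ?n"
      using det_0_iff_vec_prod_zero_field[OF mat_on_carrier[of I A]] by blast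
    moreover from this have "0 \<cdot>\<^sub>v v = 0\<^sub>v ?n" by (intro eq_vecI) auto
    ultimately have "eigenvector ?M v 0" by (simp add: eigenvector_def mat_on_def)
    then show False using inv eigenvalue_mat_on[OF fin] by (auto simp: eigenvalue_def)
  qed
  then have "?M \<in> Units (ring_mat TYPE('a) ?n ())"
    by (rule det_non_zero_imp_unit[OF mat_on_carrier])
  then have "mat_inverse ?M \<noteq> None"
    using mat_inverse(1)[OF mat_on_carrier[of I A], of "()"] by (rule contrapos_pn)
  then have "mat_inverse ?M = Some N" by (auto simp: N_def)
  from mat_inverse(2)[OF mat_on_carrier this]
  have N: "?M * N = 1\<^sub>m ?n" "N * ?M = 1\<^sub>m ?n" "N \<in> carrier_mat ?n ?n" by auto
  show NG: "N = mat_on I G" unfolding G_def by (rule mat_on_entry_on[OF fin N(3), symmetric])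
  from N(1,2)[unfolded NG mat_on_mult[OF fin] one_mat_on[OF fin] mat_on_eq_iff[OF fin]]
  show "p \<in> I \<Longrightarrow> r \<in> I \<Longrightarrow> (\<Sum>q\<in>I. A p q * G q r) = (if p = r then 1 else 0)"
    and "p \<in> I \<Longrightarrow> r \<in> I \<Longrightarrow> (\<Sum>q\<in>I. G p q * A q r) = (if p = r then 1 else 0)" by auto
qed

text \<open>Stated for a one-sided inverse, so that it applies to a matrix and to its inverse alike and
  their eigenvalues turn out to be exactly reciprocal.\<close>

lemma eigenvalue_on_inverse:
  assumes fin: "finite I"
    and inv: "\<And>p r. p \<in> I \<Longrightarrow> r \<in> I \<Longrightarrow> (\<Sum>q\<in>I. G p q * A q r) = (if p = r then 1 else 0)"
    and ev: "eigenvalue_on I A \<mu>"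
  shows "\<mu> \<noteq> 0" and "eigenvalue_on I G (1 / \<mu>)"
proof -
  obtain x p0 where x: "p0 \<in> I" "x p0 \<noteq> 0" "\<And>p. p \<in> I \<Longrightarrow> (\<Sum>q\<in>I. A p q * x q) = \<mu> * x p"
    using eigenvalue_onE[OF ev] by metis
  have *: "x p = \<mu> * (\<Sum>q\<in>I. G p q * x q)" if p: "p \<in> I" for p
  proof -
    have "(\<Sum>r\<in>I. (if p = r then 1 else 0) * x r) = (\<Sum>r\<in>I. if p = r then x r else 0)"
      by (intro sum.cong) simp_all
    then have "x p = (\<Sum>r\<in>I. (if p = r then 1 else 0) * x r)" using p fin by simp
    also have "\<dots> = (\<Sum>r\<in>I. \<Sum>q\<in>I. G p q * (A q r * x r))"
      using inv[OF p] by (intro sum.cong) (simp_all add: sum_distrib_right[symmetric] mult.assoc[symmetric])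
    also have "\<dots> = (\<Sum>q\<in>I. \<Sum>r\<in>I. G p q * (A q r * x r))" by (rule sum.swap)
    also have "\<dots> = (\<Sum>q\<in>I. G p q * (\<mu> * x q))"
      using x(3) by (intro sum.cong) (simp_all add: sum_distrib_left[symmetric])
    finally show ?thesis by (simp add: sum_distrib_left mult_ac)
  qed
  show 0: "\<mu> \<noteq> 0" using *[OF x(1)] x(2) by auto
  show "eigenvalue_on I G (1 / \<mu>)"
  proof (rule eigenvalue_onI[of p0 I x])
    fix p assume "p \<in> I"
    from *[OF this] 0 show "(\<Sum>q\<in>I. G p q * x q) = 1 / \<mu> * x p" by simp
  qed (use x in simp_all)
qed

lemma solvable_off_spectrum:
  assumes fin: "finite J" and ev: "\<not> eigenvalue_on J A \<mu>"
  shows "\<exists>z. \<forall>p\<in>J. (\<Sum>q\<in>J. A p q * z q) - \<mu> * z p = b p"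
proof -
  define A' where "A' = (\<lambda>p q. A p q - (if p = q then \<mu> else 0))"
  have A': "(\<Sum>q\<in>J. A' p q * z q) = (\<Sum>q\<in>J. A p q * z q) - \<mu> * z p" if "p \<in> J" for p z
  proof -
    have "(\<Sum>q\<in>J. A' p q * z q) = (\<Sum>q\<in>J. A p q * z q - (if p = q then \<mu> * z q else 0))"
      unfolding A'_def by (intro sum.cong) (auto simp: algebra_simps)
    then show ?thesis using that fin by (simp add: sum_subtractf)
  qed
  have "\<not> eigenvalue_on J A' 0"
  proof
    assume "eigenvalue_on J A' 0"
    then obtain x p0 where "p0 \<in> J" "x p0 \<noteq> 0" "\<And>p. p \<in> J \<Longrightarrow> (\<Sum>q\<in>J. A' p q * x q) = 0 * x p"
      unfolding eigenvalue_on_def by blast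
    then have "eigenvalue_on J A \<mu>" by (intro eigenvalue_onI[of p0 J x]) (simp_all add: A')
    then show False using ev by simp
  qed
  from mat_inverse_mat_on(2)[OF fin this] obtain G where
    G: "\<And>p r. p \<in> J \<Longrightarrow> r \<in> J \<Longrightarrow> (\<Sum>q\<in>J. A' p q * G q r) = (if p = r then 1 else 0)" by metis
  have "(\<Sum>q\<in>J. A' p q * (\<Sum>r\<in>J. G q r * b r)) = b p" if p: "p \<in> J" for p
  proof -
    have "(\<Sum>q\<in>J. A' p q * (\<Sum>r\<in>J. G q r * b r)) = (\<Sum>q\<in>J. \<Sum>r\<in>J. A' p q * G q r * b r)"
      by (simp add: sum_distrib_left mult.assoc)
    also have "\<dots> = (\<Sum>r\<in>J. \<Sum>q\<in>J. A' p q * G q r * b r)" by (rule sum.swap)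
    also have "\<dots> = (\<Sum>r\<in>J. (if p = r then 1 else 0) * b r)"
      using G[OF p] by (intro sum.cong) (simp_all add: sum_distrib_right[symmetric])
    also have "\<dots> = (\<Sum>r\<in>J. if p = r then b r else 0)" by (intro sum.cong) simp_all
    finally show ?thesis using p fin by simp
  qed
  then show ?thesis using A' by (intro exI[of _ "\<lambda>q. \<Sum>r\<in>J. G q r * b r"]) simp
qed

lemma real_spectral_radius_mat_on:
  assumes "finite J" "J \<noteq> {}"
  shows "\<exists>\<kappa>. eigenvalue_on J (\<lambda>p q. complex_of_real (G p q)) \<kappa> \<and> real_spectral_radius (mat_on J G) = cmod \<kappa>"
    and "eigenvalue_on J (\<lambda>p q. complex_of_real (G p q)) \<kappa> \<Longrightarrow> cmod \<kappa> \<le> real_spectral_radius (mat_on J G)"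
proof -
  let ?G = "\<lambda>p q. complex_of_real (G p q)"
  have map: "map_mat complex_of_real (mat_on J G) = mat_on J ?G"
    by (rule eq_matI) (simp_all add: mat_on_def)
  have spec: "spectrum (mat_on J ?G) = {\<kappa>. eigenvalue_on J ?G \<kappa>}"
    unfolding spectrum_def using eigenvalue_mat_on[OF assms(1)] by blast
  have n: "card J > 0" using assms by (simp add: card_gt_0_iff)
  note mem = spectral_radius_mem_max[OF mat_on_carrier[of J ?G] n, unfolded spec]
  show "\<exists>\<kappa>. eigenvalue_on J ?G \<kappa> \<and> real_spectral_radius (mat_on J G) = cmod \<kappa>"
    using mem(1) by (auto simp: real_spectral_radius_def map)
  show "cmod \<kappa> \<le> real_spectral_radius (mat_on J G)" if "eigenvalue_on J ?G \<kappa>"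
    using mem(2)[of "cmod \<kappa>"] that by (auto simp: real_spectral_radius_def map)
qed

text \<open>A principal block \<open>J\<close> that \<open>A\<close> does not couple to the rest of \<open>I\<close> is inverted separately, so the
  block of the inverse has the reciprocals of the eigenvalues of \<open>A\<close> on \<open>J\<close> as its eigenvalues.\<close>

lemma inverse_block_spectral_radius:
  fixes A :: "'i \<Rightarrow> 'i \<Rightarrow> real"
  assumes fin: "finite I" and J: "J \<subseteq> I" "J \<noteq> {}"
    and decoupled: "\<And>p q. p \<in> J \<Longrightarrow> q \<in> I - J \<Longrightarrow> A p q = 0 \<and> A q p = 0"
    and inv: "\<not> eigenvalue_on I (\<lambda>p q. complex_of_real (A p q)) 0"
  defines "\<rho> \<equiv> real_spectral_radius (mat_on J (entry_on I (the (mat_inverse (mat_on I A)))))"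
  shows "\<exists>\<mu>. eigenvalue_on J (\<lambda>p q. complex_of_real (A p q)) \<mu> \<and> \<mu> \<noteq> 0 \<and> \<rho> = 1 / cmod \<mu>"
    and "eigenvalue_on J (\<lambda>p q. complex_of_real (A p q)) \<mu> \<Longrightarrow> \<mu> \<noteq> 0 \<and> 1 / cmod \<mu> \<le> \<rho>"
proof -
  let ?c = "\<lambda>B p q. complex_of_real (B p q)"
  define G where "G = entry_on I (the (mat_inverse (mat_on I A)))"
  have "\<not> eigenvalue_on I A 0" using eigenvalue_on_of_real[of I A 0] inv by auto
  note G = mat_inverse_mat_on(2,3)[OF fin this, folded G_def]
  have finJ: "finite J" using J(1) fin by (rule finite_subset)
  have AG: "(\<Sum>q\<in>J. ?c A p q * ?c G q r) = (if p = r then 1 else 0)"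
    and GA: "(\<Sum>q\<in>J. ?c G p q * ?c A q r) = (if p = r then 1 else 0)" if pr: "p \<in> J" "r \<in> J" for p r
  proof -
    have pI: "p \<in> I" "r \<in> I" using pr J(1) by auto
    have "(\<Sum>q\<in>J. A p q * G q r) = (\<Sum>q\<in>I. A p q * G q r)"
      using fin J(1) decoupled[OF pr(1)] by (intro sum.mono_neutral_left) auto
    then have 1: "(\<Sum>q\<in>J. A p q * G q r) = (if p = r then 1 else 0)"
      using G(1)[OF pI] by simp
    have "(\<Sum>q\<in>J. G p q * A q r) = (\<Sum>q\<in>I. G p q * A q r)"
      using fin J(1) decoupled[OF pr(2)] by (intro sum.mono_neutral_left) auto
    then have 2: "(\<Sum>q\<in>J. G p q * A q r) = (if p = r then 1 else 0)"
      using G(2)[OF pI] by simp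
    show "(\<Sum>q\<in>J. ?c A p q * ?c G q r) = (if p = r then 1 else 0)"
      using arg_cong[OF 1, of complex_of_real] by (auto split: if_splits)
    show "(\<Sum>q\<in>J. ?c G p q * ?c A q r) = (if p = r then 1 else 0)"
      using arg_cong[OF 2, of complex_of_real] by (auto split: if_splits)
  qed
  have \<rho>: "\<rho> = real_spectral_radius (mat_on J G)" by (simp add: \<rho>_def G_def)
  show "\<mu> \<noteq> 0 \<and> 1 / cmod \<mu> \<le> \<rho>" if ev: "eigenvalue_on J (?c A) \<mu>" for \<mu>
    using eigenvalue_on_inverse[OF finJ GA ev] real_spectral_radius_mat_on(2)[OF finJ J(2), of G "1 / \<mu>"]
    by (simp add: \<rho> norm_divide)
  obtain \<kappa> where \<kappa>: "eigenvalue_on J (?c G) \<kappa>" "\<rho> = cmod \<kappa>"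
    using real_spectral_radius_mat_on(1)[OF finJ J(2), of G] unfolding \<rho> by blast
  from eigenvalue_on_inverse[OF finJ AG \<kappa>(1)]
  have "\<kappa> \<noteq> 0" "eigenvalue_on J (?c A) (1 / \<kappa>)" by auto
  then show "\<exists>\<mu>. eigenvalue_on J (?c A) \<mu> \<and> \<mu> \<noteq> 0 \<and> \<rho> = 1 / cmod \<mu>"
    using \<kappa>(2) by (intro exI[of _ "1 / \<kappa>"]) (simp add: norm_divide)
qed

section \<open>Block triangular matrices\<close>

text \<open>This lemma and the next: the eigenvalues of a block triangular matrix are those of its diagonal
  blocks, a block being a level set of \<open>r\<close>. They serve twice: for triangular weights, with the
  coordinate as level, and for the branches at a vertex, where the matrix is even block diagonal.
  Restricted to the lowest level that it meets, an eigenvector is an eigenvector of that block.\<close>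

lemma eigenvalue_on_diagonal_block:
  fixes r :: "'i \<Rightarrow> nat"
  assumes fin: "finite I" and tri: "\<And>p q. p \<in> I \<Longrightarrow> q \<in> I \<Longrightarrow> r p < r q \<Longrightarrow> A p q = 0"
    and ev: "eigenvalue_on I A \<mu>"
  shows "\<exists>k. eigenvalue_on {p \<in> I. r p = k} A \<mu>"
proof -
  obtain x p0 where x: "p0 \<in> I" "x p0 \<noteq> 0" "\<And>p. p \<in> I \<Longrightarrow> (\<Sum>q\<in>I. A p q * x q) = \<mu> * x p"
    using eigenvalue_onE[OF ev] by metis
  \<comment> \<open>The lowest level on which the eigenvector does not vanish.\<close>
  define k where "k = (LEAST k. \<exists>p\<in>I. x p \<noteq> 0 \<and> r p = k)"
  have "\<exists>p\<in>I. x p \<noteq> 0 \<and> r p = k" unfolding k_def by (rule LeastI_ex) (use x in blast)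
  then obtain p1 where p1: "p1 \<in> I" "x p1 \<noteq> 0" "r p1 = k" by blast
  have low: "x q = 0" if "q \<in> I" "r q < k" for q
    using not_less_Least[OF that(2)[unfolded k_def]] that(1) by blast
  have "(\<Sum>q\<in>{p \<in> I. r p = k}. A p q * x q) = \<mu> * x p" if p: "p \<in> I" "r p = k" for p
  proof -
    have "A p q * x q = 0" if "q \<in> I" "r q \<noteq> k" for q
      using that low[of q] tri[OF p(1), of q] p(2) by (cases "r q < k") auto
    then have "(\<Sum>q\<in>{p \<in> I. r p = k}. A p q * x q) = (\<Sum>q\<in>I. A p q * x q)"
      using fin by (intro sum.mono_neutral_left) auto
    then show ?thesis using x(3)[OF p(1)] by simp
  qed
  then show ?thesis using p1 by (intro exI[of _ k] eigenvalue_onI[of p1 _ x]) auto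
qed

text \<open>An eigenvector of a block extends by zero below and by solving linear equations above.\<close>

lemma eigenvalue_on_of_diagonal_block:
  fixes r :: "'i \<Rightarrow> nat"
  assumes fin: "finite I" and tri: "\<And>p q. p \<in> I \<Longrightarrow> q \<in> I \<Longrightarrow> r p < r q \<Longrightarrow> A p q = 0"
    and ev: "eigenvalue_on {p \<in> I. r p = k0} A \<mu>"
  shows "eigenvalue_on I A \<mu>"
proof -
  let ?L = "\<lambda>k. {p \<in> I. r p = k}"
  \<comment> \<open>Above the highest block that has the eigenvalue, the equations can be solved.\<close>
  define K where "K = {k. eigenvalue_on (?L k) A \<mu>}"
  have "K \<subseteq> r ` I"
    unfolding K_def by (auto elim!: eigenvalue_onE)
  then have finK: "finite K" using fin finite_subset by blast
  have K0: "K \<noteq> {}" using ev by (auto simp: K_def)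
  define k where "k = Max K"
  have "k \<in> K" unfolding k_def using finK K0 by simp
  then have "eigenvalue_on (?L k) A \<mu>" by (simp add: K_def)
  then obtain y p1 where y: "p1 \<in> ?L k" "y p1 \<noteq> 0"
    "\<And>p. p \<in> ?L k \<Longrightarrow> (\<Sum>q\<in>?L k. A p q * y q) = \<mu> * y p"
    unfolding eigenvalue_on_def by blast
  define J where "J = {p \<in> I. k < r p}"
  have finJ: "finite J" using fin by (simp add: J_def)
  have "\<not> eigenvalue_on J A \<mu>"
  proof
    assume "eigenvalue_on J A \<mu>"
    then obtain k' where k': "eigenvalue_on {p \<in> J. r p = k'} A \<mu>"
      using eigenvalue_on_diagonal_block[OF finJ, of r A \<mu>] tri by (auto simp: J_def)
    then have "{p \<in> J. r p = k'} \<noteq> {}" by (auto elim!: eigenvalue_onE)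
    then have "k < k'" by (auto simp: J_def)
    then have "{p \<in> J. r p = k'} = ?L k'" by (auto simp: J_def)
    then have "k' \<in> K" using k' by (simp add: K_def)
    then show False using \<open>k < k'\<close> Max_ge[OF finK] by (auto simp: k_def not_less[symmetric])
  qed
  from solvable_off_spectrum[OF finJ this, of "\<lambda>p. - (\<Sum>q\<in>?L k. A p q * y q)"]
  obtain z where z: "\<And>p. p \<in> J \<Longrightarrow>
    (\<Sum>q\<in>J. A p q * z q) - \<mu> * z p = - (\<Sum>q\<in>?L k. A p q * y q)" by blast
  define x where "x = (\<lambda>q. if k < r q then z q else if r q = k then y q else 0)"
  have split: "(\<Sum>q\<in>I. A p q * x q) = (\<Sum>q\<in>J. A p q * z q) + (\<Sum>q\<in>?L k. A p q * y q)" for p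
  proof -
    have "(\<Sum>q\<in>I. A p q * x q) = (\<Sum>q\<in>J \<union> ?L k. A p q * x q)"
      using fin by (intro sum.mono_neutral_right) (auto simp: J_def x_def)
    also have "\<dots> = (\<Sum>q\<in>J. A p q * x q) + (\<Sum>q\<in>?L k. A p q * x q)"
      using fin by (intro sum.union_disjoint) (auto simp: J_def)
    finally show ?thesis by (simp add: x_def J_def cong: sum.cong_simp)
  qed
  have "(\<Sum>q\<in>I. A p q * x q) = \<mu> * x p" if p: "p \<in> I" for p
  proof -
    consider "r p < k" | "r p = k" | "k < r p" by linarith
    then show ?thesis
    proof cases
      case 1
      then have "(\<Sum>q\<in>J. A p q * z q) = 0" "(\<Sum>q\<in>?L k. A p q * y q) = 0"
        using tri[OF p] by (auto simp: J_def intro!: sum.neutral)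
      then show ?thesis unfolding split using 1 by (simp add: x_def)
    next
      case 2
      then have "(\<Sum>q\<in>J. A p q * z q) = 0" using tri[OF p] by (auto simp: J_def intro!: sum.neutral)
      then show ?thesis unfolding split using 2 y(3)[of p] p by (simp add: x_def)
    next
      case 3
      then show ?thesis unfolding split using z[of p] p by (simp add: x_def J_def algebra_simps)
    qed
  qed
  then show ?thesis using y(1,2) by (intro eigenvalue_onI[of p1 I x]) (auto simp: x_def)
qed

section \<open>Least eigenvalue of a symmetric matrix\<close>

definition bilinear_on :: "'i set \<Rightarrow> ('i \<Rightarrow> 'i \<Rightarrow> real) \<Rightarrow> ('i \<Rightarrow> real) \<Rightarrow> ('i \<Rightarrow> real) \<Rightarrow> real" where
  "bilinear_on I A x y = (\<Sum>p\<in>I. \<Sum>q\<in>I. x p * A p q * y q)"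

definition least_eigenvalue_on :: "'i set \<Rightarrow> ('i \<Rightarrow> 'i \<Rightarrow> real) \<Rightarrow> real \<Rightarrow> bool" where
  "least_eigenvalue_on I A m \<longleftrightarrow> eigenvalue_on I A m \<and>
     (\<forall>y. m * (\<Sum>p\<in>I. (y p)\<^sup>2) \<le> bilinear_on I A y y)"

lemma bilinear_on_eq: "bilinear_on I A x y = (\<Sum>p\<in>I. x p * (\<Sum>q\<in>I. A p q * y q))"
  by (simp add: bilinear_on_def sum_distrib_left mult.assoc)

lemma bilinear_on_sym:
  assumes "\<And>p q. p \<in> I \<Longrightarrow> q \<in> I \<Longrightarrow> A p q = A q p"
  shows "bilinear_on I A x y = bilinear_on I A y x"
proof -
  have "bilinear_on I A x y = (\<Sum>q\<in>I. \<Sum>p\<in>I. x p * A p q * y q)"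
    unfolding bilinear_on_def by (rule sum.swap)
  also have "\<dots> = bilinear_on I A y x"
    unfolding bilinear_on_def using assms by (intro sum.cong) (simp_all add: mult_ac)
  finally show ?thesis .
qed

lemma bilinear_on_add_scaled:
  "bilinear_on I A (\<lambda>p. x p + t * d p) (\<lambda>p. x p + t * d p) =
     bilinear_on I A x x + t * (bilinear_on I A x d + bilinear_on I A d x) + t\<^sup>2 * bilinear_on I A d d"
  unfolding bilinear_on_def
  by (simp add: algebra_simps sum.distrib sum_distrib_left power2_eq_square)

text \<open>The first order condition at the minimum \<open>t = 0\<close> of a quadratic polynomial.\<close>

lemma linear_term_zero:
  fixes a c :: real
  assumes "\<And>t. 0 \<le> 2 * t * a + t\<^sup>2 * c"
  shows "a = 0"
proof (rule ccontr)
  assume a: "a \<noteq> 0"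
  define e where "e = \<bar>c\<bar> + 1"
  define t where "t = - a / e"
  have pos: "e > 0" by (simp add: e_def)
  have "2 * t * a + t\<^sup>2 * c = (a\<^sup>2 / e\<^sup>2) * (c - 2 * e)"
    using pos unfolding t_def by (simp add: field_simps power2_eq_square)
  moreover have "c - 2 * e < 0" by (simp add: e_def)
  moreover have "a\<^sup>2 / e\<^sup>2 > 0" using a pos by simp
  ultimately have "2 * t * a + t\<^sup>2 * c < 0" by (metis mult_pos_neg)
  then show False using assms[of t] by simp
qed

text \<open>The first variation at a minimiser has to vanish; in the direction of the residual
  \<open>d\<close> it is a multiple of the squared norm of \<open>d\<close>.\<close>

lemma rayleigh_minimiser_eigenvector:
  assumes fin: "finite I" and sym: "\<And>p q. p \<in> I \<Longrightarrow> q \<in> I \<Longrightarrow> A p q = A q p"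
    and min: "\<And>y. m * (\<Sum>p\<in>I. (y p)\<^sup>2) \<le> bilinear_on I A y y"
    and eq: "bilinear_on I A x x = m * (\<Sum>p\<in>I. (x p)\<^sup>2)" and p: "p \<in> I"
  shows "(\<Sum>q\<in>I. A p q * x q) = m * x p"
proof -
  define d where "d = (\<lambda>p. (\<Sum>q\<in>I. A p q * x q) - m * x p)"
  have sq: "(\<Sum>p\<in>I. (x p + t * d p)\<^sup>2) =
      (\<Sum>p\<in>I. (x p)\<^sup>2) + 2 * t * (\<Sum>p\<in>I. d p * x p) + t\<^sup>2 * (\<Sum>p\<in>I. (d p)\<^sup>2)" for t
    by (simp add: power2_eq_square algebra_simps sum.distrib sum_distrib_left)
  have Ax: "(\<Sum>q\<in>I. A p q * x q) = d p + m * x p" for p by (simp add: d_def)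
  have "bilinear_on I A d x - m * (\<Sum>p\<in>I. d p * x p) = (\<Sum>p\<in>I. (d p)\<^sup>2)"
    unfolding bilinear_on_eq Ax sum_distrib_left sum_subtractf[symmetric]
    by (intro sum.cong) (simp_all add: power2_eq_square algebra_simps)
  then have var: "bilinear_on I A d x = m * (\<Sum>p\<in>I. d p * x p) + (\<Sum>p\<in>I. (d p)\<^sup>2)" by simp
  have Bxd: "bilinear_on I A x d = bilinear_on I A d x" by (rule bilinear_on_sym[OF sym])
  have "0 \<le> 2 * t * (\<Sum>p\<in>I. (d p)\<^sup>2) + t\<^sup>2 * (bilinear_on I A d d - m * (\<Sum>p\<in>I. (d p)\<^sup>2))" for t
    using min[of "\<lambda>p. x p + t * d p"]
    unfolding bilinear_on_add_scaled sq Bxd var eq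
    by (simp add: algebra_simps)
  then have "(\<Sum>p\<in>I. (d p)\<^sup>2) = 0" by (rule linear_term_zero)
  then have "d p = 0" using fin p by (simp add: sum_nonneg_eq_0_iff)
  then show ?thesis by (simp add: d_def)
qed

text \<open>Vectors are normalised to vanish off \<open>I\<close>: the sphere is then a closed subset of a product of
  compact intervals and points.\<close>

lemma compact_unit_sphere_on:
  assumes fin: "finite I"
  shows "compact {x :: 'i \<Rightarrow> real. (\<forall>i. i \<notin> I \<longrightarrow> x i = 0) \<and> (\<Sum>p\<in>I. (x p)\<^sup>2) = 1}"
proof -
  let ?box = "PiE UNIV (\<lambda>i. if i \<in> I then {-1..1} else {0}) :: ('i \<Rightarrow> real) set"
  have "compactin (product_topology (\<lambda>i. euclidean) UNIV) ?box"
    unfolding compactin_PiE by auto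
  then have box: "compact ?box" by (simp add: euclidean_product_topology)
  have "continuous_on UNIV (\<lambda>x::'i \<Rightarrow> real. \<Sum>p\<in>I. (x p)\<^sup>2)"
    by (intro continuous_intros) simp
  then have "closed ((\<lambda>x::'i \<Rightarrow> real. \<Sum>p\<in>I. (x p)\<^sup>2) -` {1})"
    by (intro closed_vimage) simp_all
  then have "compact (?box \<inter> ((\<lambda>x. \<Sum>p\<in>I. (x p)\<^sup>2) -` {1}))"
    using box by (rule compact_Int_closed[rotated])
  moreover have "?box \<inter> ((\<lambda>x. \<Sum>p\<in>I. (x p)\<^sup>2) -` {1}) =
      {x. (\<forall>i. i \<notin> I \<longrightarrow> x i = 0) \<and> (\<Sum>p\<in>I. (x p)\<^sup>2) = 1}"
  proof -
    have "\<bar>x i\<bar> \<le> 1" if "(\<Sum>p\<in>I. (x p)\<^sup>2) = 1" "i \<in> I" for x :: "'i \<Rightarrow> real" and i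
      using member_le_sum[of i I "\<lambda>p. (x p)\<^sup>2"] that fin by (simp add: abs_square_le_1)
    then show ?thesis by (fastforce simp: PiE_def Pi_def abs_le_iff split: if_splits)
  qed
  ultimately show ?thesis by simp
qed

lemma ex_least_eigenvalue:
  assumes fin: "finite I" and ne: "I \<noteq> {}" and sym: "\<And>p q. p \<in> I \<Longrightarrow> q \<in> I \<Longrightarrow> A p q = A q p"
  shows "\<exists>m. least_eigenvalue_on I A m"
proof -
  let ?S = "{x :: 'a \<Rightarrow> real. (\<forall>i. i \<notin> I \<longrightarrow> x i = 0) \<and> (\<Sum>p\<in>I. (x p)\<^sup>2) = 1}"
  obtain i0 where i0: "i0 \<in> I" using ne by blast
  have "(\<Sum>p\<in>I. (if p = i0 then 1 else 0 :: real)\<^sup>2) = (\<Sum>p\<in>I. if p = i0 then 1 else 0)"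
    by (intro sum.cong) simp_all
  also have "\<dots> = 1" using i0 fin by simp
  finally have "(\<lambda>p. if p = i0 then 1 else 0) \<in> ?S" using i0 by simp
  then have "\<exists>x. x \<in> ?S" by (rule exI[of "\<lambda>x. x \<in> ?S"])
  then have "?S \<noteq> {}" unfolding ex_in_conv .
  moreover have "continuous_on ?S (\<lambda>x. bilinear_on I A x x)"
  proof -
    have "continuous_on ?S (\<lambda>x. x p)" for p
      by (rule continuous_on_subset[OF continuous_on_product_coordinates subset_UNIV])
    then show ?thesis
      unfolding bilinear_on_def by (intro continuous_on_sum continuous_on_mult continuous_on_const)
  qed
  ultimately have "\<exists>x\<in>?S. \<forall>y\<in>?S. bilinear_on I A x x \<le> bilinear_on I A y y"
    by (intro continuous_attains_inf compact_unit_sphere_on[OF fin])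
  then obtain x where x: "x \<in> ?S"
    and xmin: "\<And>y. y \<in> ?S \<Longrightarrow> bilinear_on I A x x \<le> bilinear_on I A y y"
    by blast
  define m where "m = bilinear_on I A x x"
  have min: "m * (\<Sum>p\<in>I. (y p)\<^sup>2) \<le> bilinear_on I A y y" for y
  proof (cases "(\<Sum>p\<in>I. (y p)\<^sup>2) = 0")
    case True
    then have "\<forall>p\<in>I. y p = 0" using fin by (simp add: sum_nonneg_eq_0_iff)
    then show ?thesis using True by (simp add: bilinear_on_def)
  next
    case False
    define c where "c = (\<Sum>p\<in>I. (y p)\<^sup>2)"
    have c: "c > 0" using False sum_nonneg[of I "\<lambda>p. (y p)\<^sup>2"] by (simp add: c_def less_le)
    define y' where "y' = (\<lambda>p. if p \<in> I then y p / sqrt c else 0)"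
    have "(\<Sum>p\<in>I. (y' p)\<^sup>2) = (\<Sum>p\<in>I. (y p)\<^sup>2 / c)"
      using c by (intro sum.cong) (simp_all add: y'_def power_divide)
    also have "\<dots> = 1" using c by (simp add: sum_divide_distrib[symmetric] c_def[symmetric])
    finally have "y' \<in> ?S" by (simp add: y'_def)
    then have "m \<le> bilinear_on I A y' y'" unfolding m_def by (rule xmin)
    also have "\<dots> = (\<Sum>p\<in>I. \<Sum>q\<in>I. y p * A p q * y q / c)"
      unfolding bilinear_on_def using c
      by (intro sum.cong) (simp_all add: y'_def)
    also have "\<dots> = bilinear_on I A y y / c" by (simp add: bilinear_on_def sum_divide_distrib)
    finally show ?thesis using c by (simp add: field_simps c_def)
  qed
  obtain p0 where "p0 \<in> I" "x p0 \<noteq> 0"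
  proof -
    have "\<exists>p\<in>I. x p \<noteq> 0"
    proof (rule ccontr)
      assume "\<not> (\<exists>p\<in>I. x p \<noteq> 0)"
      then have "(\<Sum>p\<in>I. (x p)\<^sup>2) = 0" by simp
      then show False using x by simp
    qed
    then show thesis using that by blast
  qed
  moreover have "(\<Sum>q\<in>I. A p q * x q) = m * x p" if "p \<in> I" for p
    by (rule rayleigh_minimiser_eigenvector[OF fin sym min _ that]) (use x in \<open>simp_all add: m_def\<close>)
  ultimately have "eigenvalue_on I A m" by (rule eigenvalue_onI)
  then show ?thesis using min by (auto simp: least_eigenvalue_on_def)
qed

text \<open>Adding the energies of the real and the imaginary part of an eigenvector cancels the terms
  with \<open>Im \<mu>\<close>.\<close>

lemma eigenvalue_ge_least:
  assumes fin: "finite I" and m: "least_eigenvalue_on I A m"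
    and ev: "eigenvalue_on I (\<lambda>p q. complex_of_real (A p q)) \<mu>"
  shows "m \<le> Re \<mu>"
proof -
  obtain z p0 where z: "p0 \<in> I" "z p0 \<noteq> 0"
    "\<And>p. p \<in> I \<Longrightarrow> (\<Sum>q\<in>I. complex_of_real (A p q) * z q) = \<mu> * z p"
    using eigenvalue_onE[OF ev] by metis
  define a where "a = (\<lambda>p. Re (z p))"
  define b where "b = (\<lambda>p. Im (z p))"
  have Re: "(\<Sum>q\<in>I. A p q * a q) = Re \<mu> * a p - Im \<mu> * b p" if "p \<in> I" for p
    using arg_cong[OF z(3)[OF that], of Re] by (simp add: a_def b_def)
  have Im: "(\<Sum>q\<in>I. A p q * b q) = Re \<mu> * b p + Im \<mu> * a p" if "p \<in> I" for p
    using arg_cong[OF z(3)[OF that], of Im] by (simp add: a_def b_def)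
  define na where "na = (\<Sum>p\<in>I. (a p)\<^sup>2)"
  define nb where "nb = (\<Sum>p\<in>I. (b p)\<^sup>2)"
  define ab where "ab = (\<Sum>p\<in>I. a p * b p)"
  have aa: "bilinear_on I A a a = Re \<mu> * na - Im \<mu> * ab"
    unfolding bilinear_on_eq na_def ab_def sum_distrib_left[where r = "Re \<mu>"]
      sum_distrib_left[where r = "Im \<mu>"] sum_subtractf[symmetric]
    by (intro sum.cong) (simp_all only: Re, simp_all add: algebra_simps power2_eq_square)
  have bb: "bilinear_on I A b b = Re \<mu> * nb + Im \<mu> * ab"
    unfolding bilinear_on_eq nb_def ab_def sum_distrib_left[where r = "Re \<mu>"]
      sum_distrib_left[where r = "Im \<mu>"] sum.distrib[symmetric]
    by (intro sum.cong) (simp_all only: Im, simp_all add: algebra_simps power2_eq_square)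
  have n: "0 < na + nb"
  proof -
    have "0 < (a p0)\<^sup>2 + (b p0)\<^sup>2" using z(2) by (simp add: a_def b_def sum_power2_gt_zero_iff complex_eq_iff)
    also have "\<dots> \<le> (\<Sum>p\<in>I. (a p)\<^sup>2 + (b p)\<^sup>2)"
      by (rule member_le_sum[OF z(1)]) (simp_all add: fin)
    finally show ?thesis by (simp add: na_def nb_def sum.distrib)
  qed
  have "m * na \<le> bilinear_on I A a a" "m * nb \<le> bilinear_on I A b b"
    using m by (auto simp: least_eigenvalue_on_def na_def nb_def)
  then have "m * (na + nb) \<le> Re \<mu> * (na + nb)" using aa bb by (simp add: algebra_simps)
  then show "m \<le> Re \<mu>" using n by simp
qed

section \<open>The Laplacian with positive definite weights\<close>

text \<open>The block Laplacian with the weights given by their entries. The block size does not occur, so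
  the submatrix of the entries whose coordinates lie in \<open>S\<close> is again of this form; singletons \<open>S\<close>
  give the scalar weights that sit on the diagonal of triangular ones.\<close>

definition weighted_laplacian ::
    "'v set set \<Rightarrow> ('v set \<Rightarrow> nat \<Rightarrow> nat \<Rightarrow> real) \<Rightarrow> 'v \<times> nat \<Rightarrow> 'v \<times> nat \<Rightarrow> real" where
  "weighted_laplacian E \<omega> p q =
     (if fst p = fst q then \<Sum>e\<in>{e \<in> E. fst p \<in> e}. \<omega> e (snd p) (snd q)
      else if {fst p, fst q} \<in> E then - \<omega> {fst p, fst q} (snd p) (snd q) else 0)"

lemma bilinear_on_extend_zero:
  assumes "finite I" "J \<subseteq> I"
  shows "bilinear_on I A (\<lambda>p. if p \<in> J then x p else 0) (\<lambda>p. if p \<in> J then x p else 0) = bilinear_on J A x x"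
proof -
  let ?y = "\<lambda>p. if p \<in> J then x p else 0"
  have inner: "(\<Sum>q\<in>I. ?y p * A p q * ?y q) = (\<Sum>q\<in>J. ?y p * A p q * x q)" for p
    using assms by (intro sum.mono_neutral_cong_right) auto
  show ?thesis unfolding bilinear_on_def inner
    using assms finite_subset[OF assms(2,1)] by (intro sum.mono_neutral_cong_right) auto
qed

lemma eigenvector_energy:
  assumes "\<And>p. p \<in> I \<Longrightarrow> (\<Sum>q\<in>I. A p q * x q) = m * x p"
  shows "bilinear_on I A x x = m * (\<Sum>p\<in>I. (x p)\<^sup>2)"
  unfolding bilinear_on_eq sum_distrib_left[where r = m] using assms
  by (intro sum.cong) (simp_all add: power2_eq_square)

lemma sum_squares_pos:
  fixes x :: "'i \<Rightarrow> real"
  assumes "finite I" "p \<in> I" "x p \<noteq> 0" shows "0 < (\<Sum>p\<in>I. (x p)\<^sup>2)"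
proof -
  have "0 < (x p)\<^sup>2" using assms(3) by simp
  also have "\<dots> \<le> (\<Sum>p\<in>I. (x p)\<^sup>2)" using assms by (intro member_le_sum) simp_all
  finally show ?thesis .
qed

locale weighted_tree = tree_graph V E for V :: "'v set" and E +
  fixes \<omega> :: "'v set \<Rightarrow> nat \<Rightarrow> nat \<Rightarrow> real" and S :: "nat set"
  assumes finite_S: "finite S" and S_nonempty: "S \<noteq> {}"
    and symmetric: "\<And>e i j. e \<in> E \<Longrightarrow> i \<in> S \<Longrightarrow> j \<in> S \<Longrightarrow> \<omega> e i j = \<omega> e j i"
    and definite: "\<And>e z i. e \<in> E \<Longrightarrow> i \<in> S \<Longrightarrow> z i \<noteq> 0 \<Longrightarrow> 0 < bilinear_on S (\<omega> e) z z"
begin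

abbreviation L where "L \<equiv> weighted_laplacian E \<omega>"

abbreviation nbs where "nbs u \<equiv> {v. {u, v} \<in> E}"

lemma laplacian_sym: "snd p \<in> S \<Longrightarrow> snd q \<in> S \<Longrightarrow> L p q = L q p"
  by (auto simp: weighted_laplacian_def insert_commute symmetric intro!: sum.cong)

lemma nbs_subset: "nbs u \<subseteq> V - {u}"
  using edgeD by fast

lemma sum_incident_edges:
  assumes "u \<in> V" shows "(\<Sum>e\<in>{e \<in> E. u \<in> e}. g e) = (\<Sum>v\<in>nbs u. g {u, v})"
proof -
  have "inj_on (\<lambda>v. {u, v}) (nbs u)" by (auto simp: inj_on_def doubleton_eq_iff)
  moreover have "(\<lambda>v. {u, v}) ` nbs u = {e \<in> E. u \<in> e}"
  proof (intro equalityI subsetI)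
    fix e assume e: "e \<in> {e \<in> E. u \<in> e}"
    then obtain a b where ab: "e = {a, b}"
      using tree unfolding finite_tree_def simple_graph_def by blast
    then have "u = a \<or> u = b" using e by auto
    then have "\<exists>v. e = {u, v}" using ab by (auto simp: insert_commute)
    then show "e \<in> (\<lambda>v. {u, v}) ` nbs u" using e by blast
  qed auto
  ultimately show ?thesis using sum.reindex[of "\<lambda>v. {u, v}" "nbs u" g] by simp
qed

lemma laplacian_row:
  assumes "u \<in> V"
  shows "(\<Sum>q\<in>V \<times> S. L (u, i) q * y q) =
    (\<Sum>v\<in>nbs u. \<Sum>j\<in>S. \<omega> {u, v} i j * (y (u, j) - y (v, j)))"
proof -
  have diag: "(\<Sum>j\<in>S. L (u, i) (u, j) * y (u, j)) = (\<Sum>v\<in>nbs u. \<Sum>j\<in>S. \<omega> {u, v} i j * y (u, j))"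
  proof -
    have "(\<Sum>j\<in>S. L (u, i) (u, j) * y (u, j)) = (\<Sum>j\<in>S. \<Sum>v\<in>nbs u. \<omega> {u, v} i j * y (u, j))"
      by (intro sum.cong) (simp_all add: weighted_laplacian_def sum_incident_edges[OF assms] sum_distrib_right)
    also have "\<dots> = (\<Sum>v\<in>nbs u. \<Sum>j\<in>S. \<omega> {u, v} i j * y (u, j))" by (rule sum.swap)
    finally show ?thesis .
  qed
  have off: "(\<Sum>v\<in>V - {u}. \<Sum>j\<in>S. L (u, i) (v, j) * y (v, j)) =
      (\<Sum>v\<in>nbs u. \<Sum>j\<in>S. - (\<omega> {u, v} i j * y (v, j)))"
    using nbs_subset[of u] finite_V finite_S
    by (intro sum.mono_neutral_cong_right) (auto simp: weighted_laplacian_def intro!: sum.cong sum.neutral)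
  have "(\<Sum>q\<in>V \<times> S. L (u, i) q * y q) = (\<Sum>v\<in>V. \<Sum>j\<in>S. L (u, i) (v, j) * y (v, j))"
    by (simp add: sum.cartesian_product case_prod_unfold)
  also have "\<dots> = (\<Sum>j\<in>S. L (u, i) (u, j) * y (u, j)) + (\<Sum>v\<in>V - {u}. \<Sum>j\<in>S. L (u, i) (v, j) * y (v, j))"
    by (rule sum.remove[OF finite_V assms])
  also have "\<dots> = (\<Sum>v\<in>nbs u. \<Sum>j\<in>S. \<omega> {u, v} i j * (y (u, j) - y (v, j)))"
    unfolding diag off sum.distrib[symmetric] by (simp add: right_diff_distrib)
  finally show ?thesis .
qed

lemma sum_arcs_swap:
  "(\<Sum>u\<in>V. \<Sum>v\<in>nbs u. g u v) = (\<Sum>u\<in>V. \<Sum>v\<in>nbs u. g v u)" for g :: "'v \<Rightarrow> 'v \<Rightarrow> real"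
proof -
  have *: "(\<Sum>u\<in>V. \<Sum>v\<in>nbs u. h u v) = (\<Sum>u\<in>V. \<Sum>v\<in>V. if {u, v} \<in> E then h u v else 0)"
    for h :: "'v \<Rightarrow> 'v \<Rightarrow> real"
  proof (rule sum.cong[OF refl])
    fix u
    show "(\<Sum>v\<in>nbs u. h u v) = (\<Sum>v\<in>V. if {u, v} \<in> E then h u v else 0)"
      using nbs_subset[of u] finite_V by (intro sum.mono_neutral_cong_left) auto
  qed
  show ?thesis unfolding * by (subst sum.swap) (simp add: insert_commute)
qed

text \<open>Twice the energy, since the outer sum visits every edge from both ends.\<close>

lemma laplacian_energy:
  "2 * bilinear_on (V \<times> S) L y y =
    (\<Sum>u\<in>V. \<Sum>v\<in>nbs u.
      bilinear_on S (\<omega> {u, v}) (\<lambda>i. y (u, i) - y (v, i)) (\<lambda>i. y (u, i) - y (v, i)))"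
proof -
  define g where "g u v = (\<Sum>i\<in>S. \<Sum>j\<in>S. y (u, i) * \<omega> {u, v} i j * (y (u, j) - y (v, j)))" for u v
  have "bilinear_on (V \<times> S) L y y = (\<Sum>u\<in>V. \<Sum>i\<in>S. y (u, i) * (\<Sum>q\<in>V \<times> S. L (u, i) q * y q))"
    by (simp add: bilinear_on_eq sum.cartesian_product case_prod_unfold)
  also have "\<dots> = (\<Sum>u\<in>V. \<Sum>v\<in>nbs u. g u v)"
  proof (rule sum.cong[OF refl])
    fix u assume u: "u \<in> V"
    have "(\<Sum>i\<in>S. y (u, i) * (\<Sum>q\<in>V \<times> S. L (u, i) q * y q)) =
        (\<Sum>i\<in>S. \<Sum>v\<in>nbs u. \<Sum>j\<in>S. y (u, i) * \<omega> {u, v} i j * (y (u, j) - y (v, j)))"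
      unfolding laplacian_row[OF u] by (simp add: sum_distrib_left mult.assoc)
    also have "\<dots> = (\<Sum>v\<in>nbs u. g u v)" unfolding g_def by (rule sum.swap)
    finally show "(\<Sum>i\<in>S. y (u, i) * (\<Sum>q\<in>V \<times> S. L (u, i) q * y q)) = (\<Sum>v\<in>nbs u. g u v)" .
  qed
  finally have B: "bilinear_on (V \<times> S) L y y = (\<Sum>u\<in>V. \<Sum>v\<in>nbs u. g u v)" .
  have gg: "g u v + g v u =
      bilinear_on S (\<omega> {u, v}) (\<lambda>i. y (u, i) - y (v, i)) (\<lambda>i. y (u, i) - y (v, i))" for u v
    unfolding g_def bilinear_on_def sum.distrib[symmetric] insert_commute[of v u]
    by (intro sum.cong) (simp_all add: algebra_simps)
  have "2 * bilinear_on (V \<times> S) L y y = (\<Sum>u\<in>V. \<Sum>v\<in>nbs u. g u v) + (\<Sum>u\<in>V. \<Sum>v\<in>nbs u. g v u)"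
    using B sum_arcs_swap[of g] by simp
  also have "\<dots> = (\<Sum>u\<in>V. \<Sum>v\<in>nbs u. g u v + g v u)" by (simp add: sum.distrib)
  finally show ?thesis unfolding gg .
qed

text \<open>A vector without energy is constant along edges, hence zero if it vanishes at one vertex.\<close>

lemma laplacian_energy_pos:
  assumes r: "r \<in> V" "\<And>i. i \<in> S \<Longrightarrow> y (r, i) = 0" and x: "x \<in> V" "i \<in> S" "y (x, i) \<noteq> 0"
  shows "0 < bilinear_on (V \<times> S) L y y"
proof -
  let ?d = "\<lambda>u v i. y (u, i) - y (v, i)"
  let ?b = "\<lambda>u v. bilinear_on S (\<omega> {u, v}) (?d u v) (?d u v)"
  have nn: "0 \<le> ?b u v" if "{u, v} \<in> E" for u v
  proof (cases "\<exists>i\<in>S. ?d u v i \<noteq> 0")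
    case True
    then obtain i where "i \<in> S" "?d u v i \<noteq> 0" by blast
    from definite[OF that this(1), of "?d u v"] this(2) show ?thesis by simp
  next
    case False
    then show ?thesis by (simp add: bilinear_on_def)
  qed
  have fn: "finite (nbs u)" for u using finite_subset[OF nbs_subset] finite_V by blast
  have "\<exists>u v. {u, v} \<in> E \<and> y (u, i) \<noteq> y (v, i)"
  proof (rule ccontr)
    assume no: "\<not> (\<exists>u v. {u, v} \<in> E \<and> y (u, i) \<noteq> y (v, i))"
    have "(r, x) \<in> joined V E" using tree r x by (auto simp: finite_tree_def graph_connected_def)
    then have "y (x, i) = 0" unfolding joined_def
      by (induction rule: rtrancl_induct) (use no r(2)[OF x(2)] in auto)
    then show False using x by simp
  qed
  then obtain u v where uv: "{u, v} \<in> E" "?d u v i \<noteq> 0" by auto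
  have uV: "u \<in> V" using edgeD(1)[OF uv(1)] .
  have "0 < ?b u v" using definite[OF uv(1) x(2), of "?d u v"] uv(2) by simp
  also have "?b u v \<le> (\<Sum>v\<in>nbs u. ?b u v)"
    using nn uv(1) fn by (intro member_le_sum) auto
  also have "\<dots> \<le> (\<Sum>u\<in>V. \<Sum>v\<in>nbs u. ?b u v)"
    using nn uV finite_V by (intro member_le_sum sum_nonneg) auto
  finally show ?thesis unfolding laplacian_energy[symmetric] by simp
qed

lemma least_eigenvalue_pos:
  assumes r: "r \<in> V" and X: "X \<subseteq> V - {r}" and m: "least_eigenvalue_on (X \<times> S) L m"
  shows "0 < m"
proof -
  have fin: "finite (X \<times> S)" using finite_subset[OF X] finite_V finite_S by blast
  from m have "eigenvalue_on (X \<times> S) L m" by (simp add: least_eigenvalue_on_def)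
  then obtain x p where x: "p \<in> X \<times> S" "x p \<noteq> 0"
    "\<And>p. p \<in> X \<times> S \<Longrightarrow> (\<Sum>q\<in>X \<times> S. L p q * x q) = m * x p"
    unfolding eigenvalue_on_def by blast
  let ?y = "\<lambda>p. if p \<in> X \<times> S then x p else 0"
  have "0 < bilinear_on (V \<times> S) L ?y ?y"
    by (rule laplacian_energy_pos[of r _ "fst p" "snd p"]) (use r X x in auto)
  also have "\<dots> = m * (\<Sum>p\<in>X \<times> S. (x p)\<^sup>2)"
    using bilinear_on_extend_zero[of "V \<times> S" "X \<times> S" L x] eigenvector_energy[of "X \<times> S" L x m, OF x(3)]
      X finite_V finite_S by auto
  finally show ?thesis using sum_squares_pos[of "X \<times> S" p x] fin x(1,2) by (simp add: zero_less_mult_iff)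
qed

lemma ex_least_laplacian:
  assumes "X \<subseteq> V" "X \<noteq> {}" shows "\<exists>m. least_eigenvalue_on (X \<times> S) L m"
  using assms finite_subset[OF assms(1) finite_V] finite_S S_nonempty
  by (intro ex_least_eigenvalue) (auto intro: laplacian_sym)

lemma laplacian_eigenvalue_nonzero:
  assumes "r \<in> V"
  shows "\<not> eigenvalue_on ((V - {r}) \<times> S) (\<lambda>p q. complex_of_real (L p q)) 0"
proof
  assume ev: "eigenvalue_on ((V - {r}) \<times> S) (\<lambda>p q. complex_of_real (L p q)) 0"
  then have "V - {r} \<noteq> {}" by (auto elim!: eigenvalue_onE)
  then obtain m where m: "least_eigenvalue_on ((V - {r}) \<times> S) L m" using ex_least_laplacian by blast
  have "m \<le> Re 0"
    using finite_V finite_S by (intro eigenvalue_ge_least[OF _ m ev]) auto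
  then show False using least_eigenvalue_pos[OF assms subset_refl m] by simp
qed

text \<open>The strict comparison of nested branches, which carries the whole theorem. The least eigenvalue
  is the minimum of the Rayleigh quotient, so extension by zero of an eigenvector \<open>x\<close> on the
  smaller branch gives \<open>m \<le> m'\<close>. In case of equality the extension is an eigenvector on the larger
  branch, and its row at \<open>u\<close> makes \<open>x\<close> vanish at \<open>w\<close> by definiteness of the weight. Then \<open>x\<close> lives
  on the branches at \<open>w\<close> beyond \<open>u\<close>, and one of these has \<open>m'\<close> as an eigenvalue; but by
  induction its least eigenvalue exceeds \<open>m'\<close>. For matrix weights there is no positive
  eigenvector, so this replaces the usual Perron-Frobenius argument.\<close>

lemma least_eigenvalue_branch_less:
  assumes "{v, u} \<in> E" "{u, w} \<in> E" "w \<noteq> v"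
    and "least_eigenvalue_on (branch V E v u \<times> S) L m"
    and "least_eigenvalue_on (branch V E u w \<times> S) L m'"
  shows "m < m'"
  using assms
proof (induction "card (branch V E u w)" arbitrary: v u w m m' rule: less_induct)
  case less
  note vu = \<open>{v, u} \<in> E\<close> and uw = \<open>{u, w} \<in> E\<close>
  note m = \<open>least_eigenvalue_on (branch V E v u \<times> S) L m\<close>
  note m' = \<open>least_eigenvalue_on (branch V E u w \<times> S) L m'\<close>
  let ?X = "branch V E v u" and ?X' = "branch V E u w"
  let ?I = "?X \<times> S" and ?I' = "?X' \<times> S"
  have sub: "?X' \<subset> ?X" by (rule branch_psubset[OF vu uw \<open>w \<noteq> v\<close>])
  have fV: "finite B" if "B \<subseteq> V" for B using that finite_V finite_subset by blast
  have finX: "finite ?X" "finite ?X'" using branch_subset by (intro fV; blast)+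
  have fin: "finite ?I" "finite ?I'" using finX finite_S by auto
  have II: "?I' \<subseteq> ?I" using sub by auto
  from m' have "eigenvalue_on ?I' L m'" by (simp add: least_eigenvalue_on_def)
  then obtain x p0 where x: "p0 \<in> ?I'" "x p0 \<noteq> 0"
    "\<And>p. p \<in> ?I' \<Longrightarrow> (\<Sum>q\<in>?I'. L p q * x q) = m' * x p"
    unfolding eigenvalue_on_def by blast
  define y where "y = (\<lambda>p. if p \<in> ?I' then x p else 0)"
  have norm_y: "(\<Sum>p\<in>?I. (y p)\<^sup>2) = (\<Sum>p\<in>?I'. (x p)\<^sup>2)"
    using fin II by (intro sum.mono_neutral_cong_right) (auto simp: y_def)
  have energy_y: "bilinear_on ?I L y y = m' * (\<Sum>p\<in>?I. (y p)\<^sup>2)"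
    unfolding y_def bilinear_on_extend_zero[OF fin(1) II]
    using eigenvector_energy[of ?I' L x m', OF x(3)] norm_y by (simp add: y_def)
  have min: "m * (\<Sum>p\<in>?I. (z p)\<^sup>2) \<le> bilinear_on ?I L z z" for z
    using m by (simp add: least_eigenvalue_on_def)
  have pos: "0 < (\<Sum>p\<in>?I. (y p)\<^sup>2)" unfolding norm_y 
    by (rule sum_squares_pos[of _ p0 x]) (use fin(2) x in auto)
  have "m \<le> m'" using min[of y] pos unfolding energy_y by simp
  moreover have "m \<noteq> m'"
  proof
    assume eq: "m = m'"
    have row: "(\<Sum>q\<in>?I. L p q * y q) = m * y p" if "p \<in> ?I" for p
      by (rule rayleigh_minimiser_eigenvector[OF fin(1) _ min _ that])
        (use energy_y eq laplacian_sym in auto)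
    have u: "u \<in> ?X" "u \<notin> ?X'" using neighbour_in_own_branch[OF vu] branch_subset by auto
    have w: "w \<in> ?X'" by (rule neighbour_in_own_branch[OF uw])
    \<comment> \<open>The row of \<open>u\<close> only sees the value at \<open>w\<close>.\<close>
    have zero: "(\<Sum>j\<in>S. \<omega> {u, w} i j * x (w, j)) = 0" if i: "i \<in> S" for i
    proof -
      have L0: "L (u, i) (z, j) = 0" if "z \<in> ?X'" "z \<noteq> w" for z j
        using only_neighbour_in_branch[OF uw that(1)] that u(2) by (auto simp: weighted_laplacian_def)
      have "0 = (\<Sum>q\<in>?I. L (u, i) q * y q)" using row[of "(u, i)"] u i by (simp add: y_def)
      also have "\<dots> = (\<Sum>q\<in>{w} \<times> S. L (u, i) q * x q)"
        using fin(1) II w L0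
        by (intro sum.mono_neutral_cong_right) (auto simp: y_def)
      also have "\<dots> = (\<Sum>z\<in>{w}. \<Sum>j\<in>S. L (u, i) (z, j) * x (z, j))"
        by (simp only: sum.cartesian_product case_prod_unfold prod.collapse)
      also have "\<dots> = - (\<Sum>j\<in>S. \<omega> {u, w} i j * x (w, j))"
        using edgeD(3)[OF uw] uw by (simp add: weighted_laplacian_def sum_negf)
      finally show ?thesis by simp
    qed
    have xw: "x (w, j) = 0" if "j \<in> S" for j
    proof (rule ccontr)
      assume "x (w, j) \<noteq> 0"
      from definite[OF uw that, of "\<lambda>j. x (w, j)", OF this] show False
        by (simp add: bilinear_on_eq zero)
    qed
    obtain a i where p0: "p0 = (a, i)" by (cases p0)
    have a: "a \<in> ?X'" "i \<in> S" using x(1) p0 by auto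
    have "a \<noteq> w" using x(2) xw a p0 by auto
    from subbranch[OF uw a(1) this] obtain t where t: "{w, t} \<in> E" "t \<noteq> u" "a \<in> branch V E w t" by metis
    let ?X'' = "branch V E w t"
    have sub': "?X'' \<subset> ?X'" by (rule branch_psubset[OF uw t(1,2)])
    have "(\<Sum>q\<in>?X'' \<times> S. L p q * x q) = m' * x p" if p: "p \<in> ?X'' \<times> S" for p
    proof -
      have "L p q * x q = 0" if "q \<in> ?I' - ?X'' \<times> S" for q
      proof (cases "fst q = w")
        case True
        then have "x q = 0" using xw[of "snd q"] that by (cases q) auto
        then show ?thesis by simp
      next
        case False
        then have "{fst p, fst q} \<notin> E" "fst p \<noteq> fst q"
          using p that branch_closed[of "fst p" w t "fst q"] by auto
        then show ?thesis by (simp add: weighted_laplacian_def)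
      qed
      then have "(\<Sum>q\<in>?X'' \<times> S. L p q * x q) = (\<Sum>q\<in>?I'. L p q * x q)"
        using fin(2) sub' by (intro sum.mono_neutral_left) auto
      then show ?thesis using x(3)[of p] p sub' by auto
    qed
    then have ev: "eigenvalue_on (?X'' \<times> S) L m'"
      using t(3) a x(2) p0 by (intro eigenvalue_onI[of p0]) auto
    obtain m'' where m'': "least_eigenvalue_on (?X'' \<times> S) L m''"
      using ex_least_laplacian[of ?X''] t(3) branch_subset by blast
    have "m'' \<le> Re (complex_of_real m')"
      using finite_subset[OF psubset_imp_subset[OF sub'] finX(2)] finite_S
      by (intro eigenvalue_ge_least[OF _ m'' eigenvalue_on_of_real[OF ev]]) auto
    moreover have "m' < m''"
      using less.hyps[of w t u m' m''] psubset_card_mono[OF finX(2) sub'] uw t m' m'' by blast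
    ultimately show False by simp
  qed
  ultimately show "m < m'" by simp
qed

lemma branch_spectral_gap:
  assumes vu: "{v, u} \<in> E" and uw: "{u, w} \<in> E" and "w \<noteq> v"
  shows "\<exists>\<mu>. eigenvalue_on (branch V E v u \<times> S) (\<lambda>p q. complex_of_real (L p q)) \<mu> \<and>
    (\<forall>\<nu>. eigenvalue_on (branch V E u w \<times> S) (\<lambda>p q. complex_of_real (L p q)) \<nu> \<longrightarrow> cmod \<mu> < cmod \<nu>)"
proof -
  have "\<exists>m. least_eigenvalue_on (branch V E v u \<times> S) L m"
    by (rule ex_least_laplacian) (use branch_subset neighbour_in_own_branch[OF vu] in auto)
  then obtain m where m: "least_eigenvalue_on (branch V E v u \<times> S) L m" by blast
  have "\<exists>m'. least_eigenvalue_on (branch V E u w \<times> S) L m'"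
    by (rule ex_least_laplacian) (use branch_subset neighbour_in_own_branch[OF uw] in auto)
  then obtain m' where m': "least_eigenvalue_on (branch V E u w \<times> S) L m'" by blast
  have "0 < m" by (rule least_eigenvalue_pos[OF edgeD(1)[OF vu] branch_subset m])
  have "m < m'" by (rule least_eigenvalue_branch_less[OF vu uw \<open>w \<noteq> v\<close> m m'])
  have fin: "finite (branch V E u w \<times> S)"
    using finite_subset[OF branch_subset] finite_V finite_S by blast
  have "cmod (complex_of_real m) < cmod \<nu>"
    if "eigenvalue_on (branch V E u w \<times> S) (\<lambda>p q. complex_of_real (L p q)) \<nu>" for \<nu>
  proof -
    have "m' \<le> Re \<nu>" by (rule eigenvalue_ge_least[OF fin m' that])
    then show ?thesis using \<open>0 < m\<close> \<open>m < m'\<close> complex_Re_le_cmod[of \<nu>] by simp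
  qed
  moreover have "eigenvalue_on (branch V E v u \<times> S) (\<lambda>p q. complex_of_real (L p q)) (complex_of_real m)"
    using m by (intro eigenvalue_on_of_real) (simp add: least_eigenvalue_on_def)
  ultimately show ?thesis by blast
qed

end

section \<open>The spectral gap between nested branches\<close>

text \<open>The function \<open>r\<close> orders the coordinates: it is increasing for lower and decreasing for upper triangular
  weights.\<close>

lemma eigenvalue_on_triangular_blocks:
  fixes r :: "nat \<Rightarrow> nat"
  assumes fin: "finite X" and inj: "inj_on r {..<s}"
    and tri: "\<And>p q. p \<in> X \<times> {..<s} \<Longrightarrow> q \<in> X \<times> {..<s} \<Longrightarrow> r (snd p) < r (snd q) \<Longrightarrow> A p q = 0"
  shows "eigenvalue_on (X \<times> {..<s}) A \<mu> \<longleftrightarrow> (\<exists>i<s. eigenvalue_on (X \<times> {i}) A \<mu>)"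
proof -
  let ?I = "X \<times> {..<s}"
  have block: "{p \<in> ?I. r (snd p) = r i} = X \<times> {i}" if "i < s" for i
    using inj that by (auto simp: inj_on_def)
  have finI: "finite ?I" using fin by simp
  show ?thesis
  proof
    assume "eigenvalue_on ?I A \<mu>"
    from eigenvalue_on_diagonal_block[OF finI, of "\<lambda>p. r (snd p)", OF tri this]
    obtain k where k: "eigenvalue_on {p \<in> ?I. r (snd p) = k} A \<mu>" by blast
    then obtain p where "p \<in> ?I" "r (snd p) = k" by (auto elim!: eigenvalue_onE)
    then show "\<exists>i<s. eigenvalue_on (X \<times> {i}) A \<mu>" using k block[of "snd p"] by auto
  next
    assume "\<exists>i<s. eigenvalue_on (X \<times> {i}) A \<mu>"
    then obtain i where i: "i < s" "eigenvalue_on (X \<times> {i}) A \<mu>" by blast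
    show "eigenvalue_on ?I A \<mu>"
      by (rule eigenvalue_on_of_diagonal_block[OF finI, of "\<lambda>p. r (snd p)" A "r i", OF tri])
        (use i block[OF i(1)] in auto)
  qed
qed

text \<open>The property of the Laplacian that all three classes of weights share. The comparison of spectra
  is in terms of one small eigenvalue of the larger branch, because it then passes to the union of
  spectra that triangular weights produce. The condition on \<open>0\<close> makes the reduced Laplacians invertible.\<close>

definition spectral_gap :: "'v set \<Rightarrow> 'v set set \<Rightarrow> nat \<Rightarrow> ('v \<times> nat \<Rightarrow> 'v \<times> nat \<Rightarrow> real) \<Rightarrow> bool" where
  "spectral_gap V E s A \<longleftrightarrow>
     (\<forall>r\<in>V. \<not> eigenvalue_on ((V - {r}) \<times> {..<s}) (\<lambda>p q. complex_of_real (A p q)) 0) \<and>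
     (\<forall>v u w. {v, u} \<in> E \<longrightarrow> {u, w} \<in> E \<longrightarrow> w \<noteq> v \<longrightarrow>
        (\<exists>\<mu>. eigenvalue_on (branch V E v u \<times> {..<s}) (\<lambda>p q. complex_of_real (A p q)) \<mu> \<and>
          (\<forall>\<nu>. eigenvalue_on (branch V E u w \<times> {..<s}) (\<lambda>p q. complex_of_real (A p q)) \<nu> \<longrightarrow>
             cmod \<mu> < cmod \<nu>)))"

lemma spectral_gap_definite:
  assumes "weighted_tree V E \<omega> {..<s}"
  shows "spectral_gap V E s (weighted_laplacian E \<omega>)"
  unfolding spectral_gap_def
  using weighted_tree.laplacian_eigenvalue_nonzero[OF assms] weighted_tree.branch_spectral_gap[OF assms]
  by blast

text \<open>The spectrum is the union of the spectra for the scalar weights \<open>\<omega> e i i\<close>. Each of them has the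
  gap, and the smallest of the eigenvalues that witness it is a witness for the union.\<close>

lemma spectral_gap_triangular:
  fixes r :: "nat \<Rightarrow> nat"
  assumes tree: "finite_tree V E" and s: "0 < s" and inj: "inj_on r {..<s}"
    and diag: "\<And>e i. e \<in> E \<Longrightarrow> i < s \<Longrightarrow> 0 < \<omega> e i i"
    and tri: "\<And>e i j. e \<in> E \<Longrightarrow> i < s \<Longrightarrow> j < s \<Longrightarrow> r i < r j \<Longrightarrow> \<omega> e i j = 0"
  shows "spectral_gap V E s (weighted_laplacian E \<omega>)"
proof -
  let ?L = "\<lambda>p q. complex_of_real (weighted_laplacian E \<omega> p q)"
  interpret tree_graph V E by unfold_locales (rule tree)
  have wt: "weighted_tree V E \<omega> {i}" if "i < s" for i
  proof unfold_locales
    fix e z j assume "e \<in> E" "j \<in> {i}" "z j \<noteq> (0::real)"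
    then have "z i \<noteq> 0" "0 < \<omega> e i i" using diag that by auto
    then have "0 < (z i)\<^sup>2 * \<omega> e i i" by simp
    then show "0 < bilinear_on {i} (\<omega> e) z z" by (simp add: bilinear_on_def power2_eq_square mult_ac)
  qed auto
  have blocks: "eigenvalue_on (X \<times> {..<s}) ?L \<mu> \<longleftrightarrow> (\<exists>i<s. eigenvalue_on (X \<times> {i}) ?L \<mu>)"
    if "X \<subseteq> V" for X \<mu>
    by (rule eigenvalue_on_triangular_blocks[OF finite_subset[OF that finite_V] inj])
      (auto simp: weighted_laplacian_def tri intro!: sum.neutral)
  show ?thesis unfolding spectral_gap_def
  proof (intro conjI ballI allI impI)
    fix v assume "v \<in> V"
    then show "\<not> eigenvalue_on ((V - {v}) \<times> {..<s}) ?L 0"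
      using blocks[of "V - {v}"] weighted_tree.laplacian_eigenvalue_nonzero[OF wt] by blast
  next
    fix v u w assume E: "{v, u} \<in> E" "{u, w} \<in> E" "w \<noteq> v"
    have "\<forall>i. \<exists>\<mu>. i < s \<longrightarrow> eigenvalue_on (branch V E v u \<times> {i}) ?L \<mu> \<and>
        (\<forall>\<nu>. eigenvalue_on (branch V E u w \<times> {i}) ?L \<nu> \<longrightarrow> cmod \<mu> < cmod \<nu>)"
      using weighted_tree.branch_spectral_gap[OF wt E] by blast
    then obtain \<mu> where \<mu>: "\<And>i. i < s \<Longrightarrow> eigenvalue_on (branch V E v u \<times> {i}) ?L (\<mu> i)"
      "\<And>i \<nu>. i < s \<Longrightarrow> eigenvalue_on (branch V E u w \<times> {i}) ?L \<nu> \<Longrightarrow> cmod (\<mu> i) < cmod \<nu>" by metis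
    have "\<exists>i\<in>{..<s}. \<forall>j\<in>{..<s}. cmod (\<mu> i) \<le> cmod (\<mu> j)"
      using arg_min_if_finite[of "{..<s}" "\<lambda>i. cmod (\<mu> i)"] s by (metis finite_lessThan lessThan_empty_iff not_gr_zero not_less)
    then obtain i where i: "i < s" "\<And>j. j < s \<Longrightarrow> cmod (\<mu> i) \<le> cmod (\<mu> j)" by auto
    have X: "branch V E v u \<subseteq> V" "branch V E u w \<subseteq> V" using branch_subset by blast+
    have "eigenvalue_on (branch V E v u \<times> {..<s}) ?L (\<mu> i)" using blocks[OF X(1)] \<mu>(1)[OF i(1)] i(1) by blast
    moreover have "cmod (\<mu> i) < cmod \<nu>" if \<nu>: "eigenvalue_on (branch V E u w \<times> {..<s}) ?L \<nu>" for \<nu>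
    proof -
      obtain j where j: "j < s" "eigenvalue_on (branch V E u w \<times> {j}) ?L \<nu>" using blocks[OF X(2)] \<nu> by blast
      show ?thesis using \<mu>(2)[OF j] i(2)[OF j(1)] by simp
    qed
    ultimately show "\<exists>\<mu>. eigenvalue_on (branch V E v u \<times> {..<s}) ?L \<mu> \<and>
        (\<forall>\<nu>. eigenvalue_on (branch V E u w \<times> {..<s}) ?L \<nu> \<longrightarrow> cmod \<mu> < cmod \<nu>)" by blast
  qed
qed

lemma spectral_gap_cong:
  assumes "tree_graph V E"
    and eq: "\<And>p q. p \<in> V \<times> {..<s} \<Longrightarrow> q \<in> V \<times> {..<s} \<Longrightarrow> A p q = B p q"
    and gap: "spectral_gap V E s A"
  shows "spectral_gap V E s B"
proof -
  interpret tree_graph V E by fact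
  have "eigenvalue_on (X \<times> {..<s}) (\<lambda>p q. complex_of_real (A p q)) \<mu> \<longleftrightarrow>
      eigenvalue_on (X \<times> {..<s}) (\<lambda>p q. complex_of_real (B p q)) \<mu>" if "X \<subseteq> V" for X \<mu>
    by (intro eigenvalue_on_cong arg_cong[of _ _ complex_of_real] eq) (use that in auto)
  moreover have "branch V E v u \<subseteq> V" for v u using branch_subset by blast
  ultimately show ?thesis using gap unfolding spectral_gap_def by simp
qed

lemma laplacian_eq_weighted:
  assumes W: "\<And>e. e \<in> E \<Longrightarrow> W e \<in> carrier_mat s s" and "snd p < s" "snd q < s"
  shows "laplacian E s W p q = weighted_laplacian E (\<lambda>e i j. W e $$ (i, j)) p q"
  using assms(2,3) by (auto simp: laplacian_def laplacian_block_def weighted_laplacian_def dest!: W)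

lemma spectral_gap_laplacian:
  assumes tree: "finite_tree V E" and s: "1 \<le> s"
    and weights: "(\<forall>e\<in>E. positive_definite_mat s (W e)) \<or>
                  (\<forall>e\<in>E. pos_diag_lower_mat s (W e)) \<or>
                  (\<forall>e\<in>E. pos_diag_upper_mat s (W e))"
  shows "spectral_gap V E s (laplacian E s W)"
proof -
  let ?\<omega> = "\<lambda>e i j. W e $$ (i, j)"
  interpret tree_graph V E by unfold_locales (rule tree)
  have W: "W e \<in> carrier_mat s s" if "e \<in> E" for e
    using weights that
    by (auto simp: positive_definite_mat_def pos_diag_lower_mat_def pos_diag_upper_mat_def)
  from weights have "spectral_gap V E s (weighted_laplacian E ?\<omega>)"
  proof (elim disjE)
    assume pd: "\<forall>e\<in>E. positive_definite_mat s (W e)"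
    have "weighted_tree V E ?\<omega> {..<s}"
    proof unfold_locales
      show "{..<s} \<noteq> {}" using s by (simp add: lessThan_empty_iff)
    next
      fix e i j assume e: "e \<in> E" and ij: "i \<in> {..<s}" "j \<in> {..<s}"
      have "transpose_mat (W e) = W e" using pd e by (simp add: positive_definite_mat_def)
      then have "W e $$ (i, j) = transpose_mat (W e) $$ (i, j)" by simp
      also have "\<dots> = W e $$ (j, i)" using W[OF e] ij by (intro index_transpose_mat(1)) auto
      finally show "W e $$ (i, j) = W e $$ (j, i)" .
    next
      fix e i and z :: "nat \<Rightarrow> real" assume e: "e \<in> E" and i: "i \<in> {..<s}" "z i \<noteq> 0"
      have "vec s z \<noteq> 0\<^sub>v s"
      proof
        assume "vec s z = 0\<^sub>v s"
        then have "vec s z $ i = 0\<^sub>v s $ i" by simp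
        then show False using i by simp
      qed
      then have "0 < scalar_prod (vec s z) (W e *\<^sub>v vec s z)"
        using pd e by (simp add: positive_definite_mat_def)
      also have "\<dots> = bilinear_on {..<s} (?\<omega> e) z z"
        using W[OF e] by (simp add: scalar_prod_def bilinear_on_eq lessThan_atLeast0)
      finally show "0 < bilinear_on {..<s} (?\<omega> e) z z" .
    qed simp
    then show ?thesis by (rule spectral_gap_definite)
  next
    assume lo: "\<forall>e\<in>E. pos_diag_lower_mat s (W e)"
    show ?thesis
    proof (rule spectral_gap_triangular[where r = "\<lambda>i. i", OF tree])
      fix e i j :: nat
      fix e assume e: "e \<in> E" and ij: "i < s" "j < s" "i < j"
      have "upper_triangular (transpose_mat (W e))" using lo e by (simp add: pos_diag_lower_mat_def)
      then have "transpose_mat (W e) $$ (j, i) = 0" using ij W[OF e] by (intro upper_triangularD) auto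
      then show "W e $$ (i, j) = 0" using ij W[OF e] by simp
    qed (use s lo in \<open>auto simp: pos_diag_lower_mat_def inj_on_def\<close>)
  next
    assume up: "\<forall>e\<in>E. pos_diag_upper_mat s (W e)"
    show ?thesis
    proof (rule spectral_gap_triangular[where r = "\<lambda>i. s - i", OF tree])
      fix e and i j :: nat assume e: "e \<in> E" and ij: "i < s" "j < s" "s - i < s - j"
      have "upper_triangular (W e)" using up e by (simp add: pos_diag_upper_mat_def)
      then show "W e $$ (i, j) = 0" using ij W[OF e] by (intro upper_triangularD) auto
    qed (use s up in \<open>auto simp: pos_diag_upper_mat_def inj_on_def\<close>)
  qed
  then show ?thesis
    by (rule spectral_gap_cong[OF tree_graph_axioms, rotated])
      (auto simp: laplacian_eq_weighted[OF W])
qed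

section \<open>Perron branches\<close>

context tree_graph
begin

lemma laplacian_across_branches:
  assumes "p \<in> branch V E v u \<times> {..<s}" "q \<in> (V - {v}) \<times> {..<s} - branch V E v u \<times> {..<s}"
  shows "laplacian E s W p q = 0 \<and> laplacian E s W q p = 0"
proof -
  have "{fst p, fst q} \<notin> E" "fst p \<noteq> fst q"
    using assms branch_closed[of "fst p" v u "fst q"] by auto
  then show ?thesis using assms
    by (auto simp: laplacian_def laplacian_block_def insert_commute)
qed

lemma laplacian_eigenvalue_branches:
  assumes v: "v \<in> V"
  shows "eigenvalue_on ((V - {v}) \<times> {..<s}) (\<lambda>p q. complex_of_real (laplacian E s W p q)) \<mu> \<longleftrightarrow>
    (\<exists>B\<in>branches V E v. eigenvalue_on (B \<times> {..<s}) (\<lambda>p q. complex_of_real (laplacian E s W p q)) \<mu>)"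
proof -
  let ?I = "(V - {v}) \<times> {..<s}" and ?A = "\<lambda>p q. complex_of_real (laplacian E s W p q)"
  \<comment> \<open>Numbering the branches turns the block diagonal form into a block triangular one.\<close>
  let ?t = "to_nat_on (branches V E v)"
  define r where "r = (\<lambda>p::'v \<times> nat. ?t (branch V E v (fst p)))"
  have finI: "finite ?I" using finite_V by simp
  have "finite (branches V E v)" using finite_V by (simp add: branches_def)
  then have inj: "inj_on ?t (branches V E v)" by (intro inj_on_to_nat_on countable_finite)
  have block: "{p \<in> ?I. r p = ?t (branch V E v x)} = branch V E v x \<times> {..<s}" if x: "x \<in> V - {v}" for x
  proof -
    have "r p = ?t (branch V E v x) \<longleftrightarrow> fst p \<in> branch V E v x" if "p \<in> ?I" for p
    proof -
      have "r p = ?t (branch V E v x) \<longleftrightarrow> branch V E v (fst p) = branch V E v x"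
        unfolding r_def using that x by (intro inj_on_eq_iff[OF inj]) (auto simp: branches_def)
      also have "\<dots> \<longleftrightarrow> fst p \<in> branch V E v x"
      proof
        assume eq: "branch V E v (fst p) = branch V E v x"
        have "fst p \<in> branch V E v (fst p)" by (rule branch_refl) (use that in auto)
        then show "fst p \<in> branch V E v x" unfolding eq .
      qed (rule branch_eq)
      finally show ?thesis .
    qed
    then show ?thesis using branch_subset[of v x] by fastforce
  qed
  have tri: "?A p q = 0" if "p \<in> ?I" "q \<in> ?I" "r p < r q" for p q
  proof -
    have "q \<notin> branch V E v (fst p) \<times> {..<s}"
      using branch_eq[of "fst q" v "fst p"] that by (auto simp: r_def)
    moreover have "p \<in> branch V E v (fst p) \<times> {..<s}" using that branch_refl by auto
    ultimately show ?thesis using laplacian_across_branches[of p v "fst p" s q W] that by auto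
  qed
  show ?thesis
  proof
    assume "eigenvalue_on ?I ?A \<mu>"
    from eigenvalue_on_diagonal_block[OF finI, of r, OF tri this]
    obtain k where k: "eigenvalue_on {p \<in> ?I. r p = k} ?A \<mu>" by blast
    then obtain p where p: "p \<in> ?I" "r p = k" by (auto elim!: eigenvalue_onE)
    then have "fst p \<in> V - {v}" by auto
    then show "\<exists>B\<in>branches V E v. eigenvalue_on (B \<times> {..<s}) ?A \<mu>"
      using k block[of "fst p"] p(2) by (auto simp: r_def branches_def)
  next
    assume "\<exists>B\<in>branches V E v. eigenvalue_on (B \<times> {..<s}) ?A \<mu>"
    then obtain x where x: "x \<in> V - {v}" "eigenvalue_on (branch V E v x \<times> {..<s}) ?A \<mu>"
      by (auto simp: branches_def)
    show "eigenvalue_on ?I ?A \<mu>"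
      by (rule eigenvalue_on_of_diagonal_block[OF finI, of r ?A "?t (branch V E v x)", OF tri])
        (use x block[OF x(1)] in auto)
  qed
qed

end

theorem mainTheorem1:
  fixes V :: "'v set" and E :: "'v set set" and s :: nat and W :: "'v set \<Rightarrow> real mat"
  assumes tree: "finite_tree V E"
    and two_vertices: "2 \<le> card V"
    and size_pos: "1 \<le> s"
    and weights: "(\<forall>e\<in>E. positive_definite_mat s (W e)) \<or>
                  (\<forall>e\<in>E. pos_diag_lower_mat s (W e)) \<or>
                  (\<forall>e\<in>E. pos_diag_upper_mat s (W e))"
  defines "case1 \<equiv> \<exists>!v. v \<in> V \<and> 2 \<le> card {B. perron_branch V E s W v B}"
    and "case2 \<equiv> \<exists>!e. e \<in> E \<and> (\<exists>u v. e = {u, v} \<and>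
                    {B. perron_branch V E s W u B} = {branch V E u v} \<and>
                    {B. perron_branch V E s W v B} = {branch V E v u})"
  shows "(case1 \<or> case2) \<and> \<not> (case1 \<and> case2)"
proof -
  let ?A = "\<lambda>p q. complex_of_real (laplacian E s W p q)"
  interpret tree_graph V E by unfold_locales (rule tree)
  have gap: "spectral_gap V E s (laplacian E s W)" by (rule spectral_gap_laplacian[OF tree size_pos weights])
  define \<rho> where "\<rho> v B = real_spectral_radius (bottleneck_mat V E s W v B)" for v B
  define f where "f v u = \<rho> v (branch V E v u)" for v u
  have nz: "\<not> eigenvalue_on ((V - {v}) \<times> {..<s}) ?A 0" if "v \<in> V" for v
    using gap that by (simp add: spectral_gap_def)
  have rad: "(\<exists>\<mu>. eigenvalue_on (B \<times> {..<s}) ?A \<mu> \<and> \<mu> \<noteq> 0 \<and> \<rho> v B = 1 / cmod \<mu>) \<and>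
      (\<forall>\<mu>. eigenvalue_on (B \<times> {..<s}) ?A \<mu> \<longrightarrow> \<mu> \<noteq> 0 \<and> 1 / cmod \<mu> \<le> \<rho> v B)"
    if v: "v \<in> V" and B: "B \<in> branches V E v" for v B
  proof -
    let ?I = "(V - {v}) \<times> {..<s}" and ?J = "B \<times> {..<s}"
    obtain x where x: "x \<in> V - {v}" "B = branch V E v x" using B by (auto simp: branches_def)
    have fin: "finite ?I" using finite_V by simp
    have J: "?J \<subseteq> ?I" "?J \<noteq> {}" using x branch_subset branch_refl[of x v] size_pos by (auto simp: lessThan_empty_iff)
    have dec: "laplacian E s W p q = 0 \<and> laplacian E s W q p = 0" if "p \<in> ?J" "q \<in> ?I - ?J" for p q
      using laplacian_across_branches that unfolding x(2) by blast
    show ?thesis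
      using inverse_block_spectral_radius[OF fin J dec nz[OF v]]
      unfolding \<rho>_def bottleneck_mat_def inverse_reduced_laplacian_def reduced_laplacian_def by blast
  qed
  have whole: "(\<exists>\<mu>. eigenvalue_on ((V - {v}) \<times> {..<s}) ?A \<mu> \<and> \<mu> \<noteq> 0 \<and>
        real_spectral_radius (inverse_reduced_laplacian V E s W v) = 1 / cmod \<mu>) \<and>
      (\<forall>\<mu>. eigenvalue_on ((V - {v}) \<times> {..<s}) ?A \<mu> \<longrightarrow>
        \<mu> \<noteq> 0 \<and> 1 / cmod \<mu> \<le> real_spectral_radius (inverse_reduced_laplacian V E s W v))"
    if v: "v \<in> V" for v
  proof -
    let ?I = "(V - {v}) \<times> {..<s}"
    have fin: "finite ?I" using finite_V by simp
    have "V \<noteq> {v}" using two_vertices by auto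
    then have ne: "?I \<noteq> {}" using v size_pos by (auto simp: lessThan_empty_iff)
    have nzr: "\<not> eigenvalue_on ?I (laplacian E s W) 0"
      using eigenvalue_on_of_real[of ?I "laplacian E s W" 0] nz[OF v] by auto
    have M: "inverse_reduced_laplacian V E s W v =
        mat_on ?I (entry_on ?I (the (mat_inverse (mat_on ?I (laplacian E s W)))))"
      unfolding inverse_reduced_laplacian_def reduced_laplacian_def
      by (rule mat_inverse_mat_on(1)[OF fin nzr])
    show ?thesis unfolding M
      using inverse_block_spectral_radius[OF fin subset_refl ne _ nz[OF v]] by blast
  qed
  have perron: "perron_branch V E s W v B \<longleftrightarrow>
      B \<in> branches V E v \<and> (\<forall>B'\<in>branches V E v. \<rho> v B' \<le> \<rho> v B)" if v: "v \<in> V" for v B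
  proof -
    let ?r = "real_spectral_radius (inverse_reduced_laplacian V E s W v)"
    note br = laplacian_eigenvalue_branches[OF v, of s W]
    have le: "\<rho> v B' \<le> ?r" if B': "B' \<in> branches V E v" for B'
    proof -
      obtain \<mu> where "eigenvalue_on (B' \<times> {..<s}) ?A \<mu>" "\<rho> v B' = 1 / cmod \<mu>" using rad[OF v B'] by blast
      then show ?thesis using whole[OF v] br B' by metis
    qed
    have "\<exists>B'\<in>branches V E v. ?r \<le> \<rho> v B'"
    proof -
      obtain \<mu> where \<mu>: "eigenvalue_on ((V - {v}) \<times> {..<s}) ?A \<mu>" "?r = 1 / cmod \<mu>" using whole[OF v] by blast
      then obtain B' where "B' \<in> branches V E v" "eigenvalue_on (B' \<times> {..<s}) ?A \<mu>" using br by blast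
      then show ?thesis using rad[OF v] \<mu>(2) by metis
    qed
    then show ?thesis unfolding perron_branch_def \<rho>_def[symmetric] using le by (metis order_antisym order_trans)
  qed
  have best: "{B. perron_branch V E s W v B} = branch V E v ` best_neighbours E f v" if v: "v \<in> V" for v
    unfolding perron[OF v] branches_eq[OF v] by (auto simp: best_neighbours_def f_def)
  interpret decreasing_arcs V E f
  proof unfold_locales
    show "finite V" by (rule finite_V)
    show "u \<in> V \<and> v \<in> V \<and> u \<noteq> v" if "{u, v} \<in> E" for u v using edgeD[OF that] by blast
    show "graph_connected V E" using tree by (simp add: finite_tree_def)
    show "2 \<le> card V" by (rule two_vertices)
    show "f u w < f v u" if E: "{v, u} \<in> E" "{u, w} \<in> E" "w \<noteq> v" for v u w
    proof -
      obtain \<mu> where \<mu>: "eigenvalue_on (branch V E v u \<times> {..<s}) ?A \<mu>"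
        "\<And>\<nu>. eigenvalue_on (branch V E u w \<times> {..<s}) ?A \<nu> \<Longrightarrow> cmod \<mu> < cmod \<nu>"
        using gap E unfolding spectral_gap_def by blast
      have br: "branch V E v u \<in> branches V E v" "branch V E u w \<in> branches V E u"
        using branches_eq edgeD E by auto
      obtain \<nu> where \<nu>: "eigenvalue_on (branch V E u w \<times> {..<s}) ?A \<nu>" "f u w = 1 / cmod \<nu>"
        using rad[OF edgeD(1)[OF E(2)] br(2)] unfolding f_def by blast
      have "\<mu> \<noteq> 0" "1 / cmod \<mu> \<le> f v u"
        using rad[OF edgeD(1)[OF E(1)] br(1)] \<mu>(1) unfolding f_def by blast+
      moreover have "1 / cmod \<nu> < 1 / cmod \<mu>"
      proof -
        have "0 < cmod \<mu>" using \<open>\<mu> \<noteq> 0\<close> by simp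
        then show ?thesis using \<mu>(2)[OF \<nu>(1)] by (simp add: frac_less2)
      qed
      ultimately show ?thesis using \<nu>(2) by simp
    qed
  qed
  have inj: "inj_on (branch V E v) (best_neighbours E f v)" for v
    using inj_on_subset[OF inj_on_branch] by (simp add: best_neighbours_def subset_iff)
  have card: "card {B. perron_branch V E s W v B} = card (best_neighbours E f v)" if "v \<in> V" for v
    unfolding best[OF that] by (rule card_image[OF inj])
  have single: "{B. perron_branch V E s W u B} = {branch V E u v} \<longleftrightarrow> best_neighbours E f u = {v}"
    if e: "{u, v} \<in> E" for u v
  proof -
    have "best_neighbours E f u \<subseteq> {w. {u, w} \<in> E}" "{v} \<subseteq> {w. {u, w} \<in> E}"
      using e by (auto simp: best_neighbours_def)
    from inj_on_image_eq_iff[OF inj_on_branch this] show ?thesis unfolding best[OF edgeD(1)[OF e]] by simp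
  qed
  have 1: "case1 \<longleftrightarrow> (\<exists>!v. v \<in> V \<and> 2 \<le> card (best_neighbours E f v))"
    unfolding case1_def using card by (metis (no_types, lifting))
  have mutual: "{B. perron_branch V E s W u B} = {branch V E u v} \<and>
        {B. perron_branch V E s W v B} = {branch V E v u} \<longleftrightarrow>
      best_neighbours E f u = {v} \<and> best_neighbours E f v = {u}" if "{u, v} \<in> E" for u v
    using single[of u v] single[of v u] that by (simp add: insert_commute)
  have "e \<in> E \<and> (\<exists>u v. e = {u, v} \<and> {B. perron_branch V E s W u B} = {branch V E u v} \<and>
        {B. perron_branch V E s W v B} = {branch V E v u}) \<longleftrightarrow>
      e \<in> E \<and> (\<exists>u v. e = {u, v} \<and> best_neighbours E f u = {v} \<and> best_neighbours E f v = {u})" for e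
    by (rule conj_cong[OF refl], intro iff_exI, rule conj_cong[OF refl], rule mutual, simp)
  then have 2: "case2 \<longleftrightarrow> (\<exists>!e. e \<in> E \<and> (\<exists>u v. e = {u, v} \<and>
      best_neighbours E f u = {v} \<and> best_neighbours E f v = {u}))"
    unfolding case2_def by simp
  show ?thesis unfolding 1 2 by (rule best_neighbour_dichotomy)
qed

end
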